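(* Let $G$ be a simple, connected, non-bipartite graph with edge ideal $I_G$. Then $$\mathrm{dstab}(I_G)\le \tfrac12\big(\mathrm{card}(E(G))+\psi(G)-1\big)+1,$$ $$\mathrm{astab}(I_G)\le \max_U\Big\{\tfrac12\big(\mathrm{card}(E(G_{U\setminus N(Z)}))+\psi(G_{U\setminus N(Z)})-1\big)+1\Big\},$$ where the maximum is taken over all sets $U\subset V(G)$ such that $Z:=V(G)\setminus U$ is an independent set, $U\ne N(Z)$, and every connected component of $G_{U\setminus N(Z)}$ contains an odd cycle.
   Context: Graphs are finite. Write $V=V(G)=\{P_1,\dots,P_d\}$ for the vertex set of $G$, $E(G)$ for its edge set, and $R=K[x_1,\dots,x_d]$ with $K$ a field. The edge ideal of $G$ is $I_G=(x_ix_j : P_iP_j\in E(G))\subset R$. $\mathrm{Ass}(J)$ is the set of associated primes of $R/J$. $\mathrm{astab}(I_G)$ is the smallest $k\ge1$ such that $\mathrm{Ass}(I_G^k)=\mathrm{Ass}(I_G^{k+i})$ for all $i\ge 1$; $\mathrm{dstab}(I_G)$ is the smallest $k$ such that the maximal ideal $(x_1,\dots,x_d)$ belongs to $\mathrm{Ass}(I_G^k)$. For $S\subset V$, $G_S$ is the induced subgraph on $S$ and $N(S)$ is the set of vertices adjacent to at least one vertex of $S$ (so $N(\emptyset)=\emptyset$; the empty set is independent). $\psi(H)$ is the number of bridges of a graph $H$ (for a disconnected graph, the sum over its components). *)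

theory Defs
  imports
    "HOL-Algebra.Algebraic_Closure_Type"
    "HOL-Algebra.Ideal_Product"
    "HOL-Library.Poly_Mapping"
    "HOL-Library.Extended_Real"
begin

section \<open>Graphs\<close>

text \<open>
  A graph is given by a vertex set \<open>V\<close> and a set \<open>E\<close> of two-element subsets of \<open>V\<close>.
\<close>

definition simple_graph :: "'v set \<Rightarrow> 'v set set \<Rightarrow> bool" where
  "simple_graph V E \<longleftrightarrow> finite V \<and> (\<forall>e\<in>E. e \<subseteq> V \<and> card e = 2)"

definition adj :: "'v set set \<Rightarrow> 'v rel" where
  "adj E = {(u, v). {u, v} \<in> E}"

definition connected_graph :: "'v set \<Rightarrow> 'v set set \<Rightarrow> bool" where
  "connected_graph V E \<longleftrightarrow> V \<noteq> {} \<and> (\<forall>u\<in>V. \<forall>v\<in>V. (u, v) \<in> (adj E)\<^sup>*)"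

definition components_graph :: "'v set \<Rightarrow> 'v set set \<Rightarrow> 'v set set" where
  "components_graph V E = V // {(u, v). u \<in> V \<and> v \<in> V \<and> (u, v) \<in> (adj E)\<^sup>*}"

definition bipartite_graph :: "'v set \<Rightarrow> 'v set set \<Rightarrow> bool" where
  "bipartite_graph V E \<longleftrightarrow>
     (\<exists>A B. A \<union> B = V \<and> A \<inter> B = {} \<and> (\<forall>e\<in>E. \<exists>a\<in>A. \<exists>b\<in>B. e = {a, b}))"

text \<open>Edge set of the subgraph induced on \<open>S\<close>; its vertex set is \<open>S\<close> itself.\<close>

definition induced_edges :: "'v set set \<Rightarrow> 'v set \<Rightarrow> 'v set set" where
  "induced_edges E S = {e \<in> E. e \<subseteq> S}"

definition nbhd :: "'v set set \<Rightarrow> 'v set \<Rightarrow> 'v set" where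
  "nbhd E S = {v. \<exists>s\<in>S. {s, v} \<in> E}"

definition independent_set :: "'v set set \<Rightarrow> 'v set \<Rightarrow> bool" where
  "independent_set E S \<longleftrightarrow> (\<forall>u\<in>S. \<forall>v\<in>S. {u, v} \<notin> E)"

text \<open>A cycle is given by the list of its distinct vertices, in cyclic order.\<close>

definition graph_cycle :: "'v set set \<Rightarrow> 'v list \<Rightarrow> bool" where
  "graph_cycle E c \<longleftrightarrow> length c \<ge> 3 \<and> distinct c \<and>
     (\<forall>i<length c. {c ! i, c ! (Suc i mod length c)} \<in> E)"

definition has_odd_cycle :: "'v set set \<Rightarrow> bool" where
  "has_odd_cycle E \<longleftrightarrow> (\<exists>c. graph_cycle E c \<and> odd (length c))"

definition is_bridge :: "'v set \<Rightarrow> 'v set set \<Rightarrow> 'v set \<Rightarrow> bool" where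
  "is_bridge V E e \<longleftrightarrow>
     e \<in> E \<and> card (components_graph V (E - {e})) > card (components_graph V E)"

definition num_bridges :: "'v set \<Rightarrow> 'v set set \<Rightarrow> nat" where
  "num_bridges V E =
     (\<Sum>C\<in>components_graph V E. card {e. is_bridge C (induced_edges E C) e})"


section \<open>Edge ideals and the associated primes of their powers\<close>

text \<open>
  The exponent vectors of the monomials are the finitely supported functions \<open>'v \<Rightarrow>\<^sub>0 nat\<close>,
  so with \<open>'v\<close> finite \<open>('v, 'k) mpoly\<close> is the polynomial ring over \<open>'k\<close> with exactly one
  variable for each element of \<open>'v\<close>.
\<close>

type_synonym ('v, 'k) mpoly = "('v \<Rightarrow>\<^sub>0 nat) \<Rightarrow>\<^sub>0 'k"

abbreviation mpoly_ring :: "('v, 'k::field) mpoly ring" where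
  "mpoly_ring \<equiv> ring_of_type_algebra"

definition var :: "'v \<Rightarrow> ('v, 'k::field) mpoly" where
  "var v = Poly_Mapping.single (Poly_Mapping.single v 1) 1"

definition edge_ideal :: "'v set set \<Rightarrow> ('v, 'k::field) mpoly set" where
  "edge_ideal E = genideal mpoly_ring {var u * var v | u v. {u, v} \<in> E}"

definition max_ideal :: "('v, 'k::field) mpoly set" where
  "max_ideal = genideal mpoly_ring (range var)"

text \<open>
  The associated primes of the \<open>R\<close>-module \<open>R/J\<close>, i.e. the prime ideals that are the annihilator
  of some \<open>m \<in> R/J\<close>; an element \<open>r\<close> of \<open>R\<close> acts on \<open>R/J\<close> as multiplication by its class.
\<close>

definition Ass :: "('a, 'b) ring_scheme \<Rightarrow> 'a set \<Rightarrow> 'a set set" where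
  "Ass R J = {P. primeideal P R \<and>
     (\<exists>m\<in>carrier (R Quot J).
        P = {r \<in> carrier R. (J +>\<^bsub>R\<^esub> r) \<otimes>\<^bsub>R Quot J\<^esub> m = \<zero>\<^bsub>R Quot J\<^esub>})}"

definition Ass_pow :: "('v, 'k::field) mpoly set \<Rightarrow> nat \<Rightarrow> ('v, 'k) mpoly set set" where
  "Ass_pow I k = Ass mpoly_ring (I [^]\<^bsub>ideals_set mpoly_ring\<^esub> k)"

text \<open>Both invariants are \<open>\<infinity>\<close> if there is no \<open>k\<close> with the required property.\<close>

definition astab :: "('v, 'k::field) mpoly set \<Rightarrow> enat" where
  "astab I = Inf {enat k | k. k \<ge> 1 \<and> (\<forall>i\<ge>1. Ass_pow I k = Ass_pow I (k + i))}"

definition dstab :: "('v, 'k::field) mpoly set \<Rightarrow> enat" where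
  "dstab I = Inf {enat k | k. k \<ge> 1 \<and> max_ideal \<in> Ass_pow I k}"

text \<open>
  The sets \<open>U\<close> over which the maximum in the bound for \<open>astab\<close> is taken. For the graph with
  vertex set \<open>V\<close> the vertex set of the graph \<open>G\<^bsub>U - N(Z)\<^esub>\<close> is \<open>core V E U\<close>.
\<close>

definition core :: "'v set \<Rightarrow> 'v set set \<Rightarrow> 'v set \<Rightarrow> 'v set" where
  "core V E U = U - nbhd E (V - U)"

definition admissible :: "'v set \<Rightarrow> 'v set set \<Rightarrow> 'v set \<Rightarrow> bool" where
  "admissible V E U \<longleftrightarrow>
     U \<subseteq> V \<and> independent_set E (V - U) \<and> U \<noteq> nbhd E (V - U) \<and>
     (\<forall>C\<in>components_graph (core V E U) (induced_edges E (core V E U)).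
        has_odd_cycle (induced_edges E C))"

end

theory Submission
  imports Defs "HOL-Library.Multiset"
begin

text \<open>
  A power of the edge ideal is a monomial ideal, and a monomial lies in the \<open>t\<close>-th power iff \<open>t\<close> edges,
  with repetition, fit into its exponent vector. Looking at leading terms shows that an associated
  prime is generated by a set \<open>U\<close> of variables and is the annihilator of the class of a single
  monomial \<open>h\<close>. If \<open>Z\<close> is the complement of \<open>U\<close>, then the edges between \<open>Z\<close> and \<open>N(Z)\<close> are
  exhausted freely, so the question whether such an \<open>h\<close> exists is one about the core
  \<open>U - N(Z)\<close>: its multiset of vertices \<open>h\<close> must accommodate one more edge as soon as any vertex
  is added.

  A component of the core without an odd cycle is bipartite, and there this is impossible: the
  edge multisets belonging to two adjacent vertices can be combined, up to one edge, into an edge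
  multiset fitting into \<open>2h\<close>, and bipartite multigraphs can be halved.

  Conversely, let every component have an odd cycle. Starting from the cycle and adding ears (and
  bridges, which count twice) one builds a multiset \<open>a\<close> of vertices such that removing any one
  vertex from \<open>a\<close> leaves a union of edges. The size of \<open>a\<close> is at most the number of edges plus
  the number of bridges, which gives the bounds. As this size is odd, adding further edges to \<open>a\<close>
  serves all higher powers of the edge ideal of a connected graph by a count of degrees; for
  \<open>Z\<close> nonempty one adds vertices of \<open>N(Z)\<close> instead.
\<close>

section \<open>Ideals of a ring given by a type\<close>

abbreviation keys :: "('m \<Rightarrow>\<^sub>0 'k::zero) \<Rightarrow> 'm set" where
  "keys \<equiv> Poly_Mapping.keys"

abbreviation lookup :: "('m \<Rightarrow>\<^sub>0 'k::zero) \<Rightarrow> 'm \<Rightarrow> 'k" where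
  "lookup \<equiv> Poly_Mapping.lookup"

lemma ring_of_type_algebra_simps [simp]:
  "carrier ring_of_type_algebra = UNIV"
  "x \<otimes>\<^bsub>ring_of_type_algebra\<^esub> y = x * y"
  "x \<oplus>\<^bsub>ring_of_type_algebra\<^esub> y = x + y"
  "\<zero>\<^bsub>ring_of_type_algebra\<^esub> = 0"
  "\<one>\<^bsub>ring_of_type_algebra\<^esub> = 1"
  by (simp_all add: ring_of_type_algebra_def)

abbreviation ty :: "'a::comm_ring_1 ring" where
  "ty \<equiv> ring_of_type_algebra"

lemma ideal_tyI:
  fixes J :: "'a::comm_ring_1 set"
  assumes "0 \<in> J" "\<And>x y. x \<in> J \<Longrightarrow> y \<in> J \<Longrightarrow> x + y \<in> J" "\<And>x y. x \<in> J \<Longrightarrow> y * x \<in> J"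
  shows "ideal J ty"
proof -
  interpret R: cring "ty :: 'a ring" by (rule cring_from_type_algebra)
  show ?thesis
  proof (rule idealI)
    show "subgroup J (add_monoid ty)"
    proof (rule R.add.subgroupI)
      fix a assume "a \<in> J"
      then have "(- 1) * a \<in> J" by (rule assms(3))
      moreover have "\<ominus>\<^bsub>ty\<^esub> a = - a"
        by (rule R.minus_equality) auto
      ultimately show "\<ominus>\<^bsub>ty\<^esub> a \<in> J" by simp
    qed (use assms in auto)
  qed (use assms in \<open>auto simp: mult.commute R.ring_axioms\<close>)
qed

lemma ideal_tyD:
  fixes J :: "'a::comm_ring_1 set"
  assumes "ideal J ty"
  shows "0 \<in> J" "x \<in> J \<Longrightarrow> y \<in> J \<Longrightarrow> x + y \<in> J" "x \<in> J \<Longrightarrow> y * x \<in> J"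
    "x \<in> J \<Longrightarrow> y \<in> J \<Longrightarrow> x - y \<in> J"
proof -
  interpret ideal J ty by fact
  show "0 \<in> J" using additive_subgroup.zero_closed[OF is_additive_subgroup] by simp
  show add: "x \<in> J \<Longrightarrow> y \<in> J \<Longrightarrow> x + y \<in> J" for x y using additive_subgroup.a_closed[OF is_additive_subgroup] by simp
  show mul: "x \<in> J \<Longrightarrow> y * x \<in> J" for x y using I_l_closed[of x y] by simp
  show "x \<in> J \<Longrightarrow> y \<in> J \<Longrightarrow> x - y \<in> J" using add[of x "(- 1) * y"] mul[of y "-1"] by simp
qed

text \<open>The annihilator of the class of \<open>g\<close> is the colon ideal of \<open>J\<close>
  by \<open>g\<close>; so associated primes are prime colon ideals, and the quotient ring can be
  forgotten.\<close>

lemma Ass_ty_iff: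
  fixes J :: "'a::comm_ring_1 set"
  assumes "ideal J ty"
  shows "P \<in> Ass ty J \<longleftrightarrow> primeideal P ty \<and> (\<exists>g. P = {r. r * g \<in> J})"
proof -
  interpret J: ideal J ty by fact
  have coset: "J +>\<^bsub>ty\<^esub> x = J \<longleftrightarrow> x \<in> J" for x
    using J.a_coset_join1[of J x] J.a_coset_join2[of x J] J.a_subgroup by auto
  have "(J +>\<^bsub>ty\<^esub> r) \<otimes>\<^bsub>ty Quot J\<^esub> (J +>\<^bsub>ty\<^esub> g) = \<zero>\<^bsub>ty Quot J\<^esub> \<longleftrightarrow> r * g \<in> J" for r g
    using J.rcoset_mult_add[of r g] coset[of "r * g"] by (simp add: FactRing_def)
  moreover have "carrier (ty Quot J) = range (\<lambda>g. J +>\<^bsub>ty\<^esub> g)"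
    by (auto simp: FactRing_def A_RCOSETS_def')
  ultimately show ?thesis
    unfolding Ass_def by auto
qed

lemma primeideal_tyD:
  fixes P :: "'a::comm_ring_1 set"
  assumes "primeideal P ty"
  shows "ideal P ty" "1 \<notin> P" "x * y \<in> P \<Longrightarrow> x \<in> P \<or> y \<in> P"
proof -
  interpret primeideal P ty by fact
  show id: "ideal P ty" by (rule is_ideal)
  show "1 \<notin> P" using one_imp_carrier I_notcarr by auto
  show "x * y \<in> P \<Longrightarrow> x \<in> P \<or> y \<in> P" using I_prime[of x y] by simp
qed

section \<open>Monomial ideals\<close>

text \<open>An exponent set \<open>M\<close> stands for the span of its monomials, which makes
  membership a condition on supports. The span is an ideal once \<open>M\<close> absorbs
  addition.\<close>

definition monomial_ideal :: "'m set \<Rightarrow> ('m \<Rightarrow>\<^sub>0 'k::field) set" where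
  "monomial_ideal M = {p. keys p \<subseteq> M}"

definition add_closed :: "'m::comm_monoid_add set \<Rightarrow> bool" where
  "add_closed M \<longleftrightarrow> (\<forall>a\<in>M. \<forall>b. a + b \<in> M)"

lemma keys_minus_single:
  fixes p :: "'m \<Rightarrow>\<^sub>0 'k::field"
  shows "keys (p - Poly_Mapping.single k (lookup p k)) = keys p - {k}"
  by (auto simp: in_keys_iff lookup_minus lookup_single when_def split: if_splits)

lemma poly_mapping_induct [case_names zero single_add]:
  fixes p :: "'m \<Rightarrow>\<^sub>0 'k::field"
  assumes "Q 0"
    and "\<And>p k. k \<in> keys p \<Longrightarrow> Q (p - Poly_Mapping.single k (lookup p k)) \<Longrightarrow> Q p"
  shows "Q p"
proof (induction "card (keys p)" arbitrary: p rule: less_induct)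
  case less
  show ?case
  proof (cases "p = 0")
    case False
    then obtain k where k: "k \<in> keys p" by fastforce
    then have "card (keys (p - Poly_Mapping.single k (lookup p k))) < card (keys p)"
      unfolding keys_minus_single by (intro psubset_card_mono) auto
    from less[OF this] assms(2) k show ?thesis by blast
  qed (use assms in simp)
qed

lemma ideal_monomial_ideal:
  assumes "add_closed M"
  shows "ideal (monomial_ideal M :: ('m::comm_monoid_add \<Rightarrow>\<^sub>0 'k::field) set) ty"
proof (rule ideal_tyI)
  fix x y :: "'m \<Rightarrow>\<^sub>0 'k"
  show "x \<in> monomial_ideal M \<Longrightarrow> y \<in> monomial_ideal M \<Longrightarrow> x + y \<in> monomial_ideal M"
    using keys_add[of x y] by (auto simp: monomial_ideal_def)
  show "x \<in> monomial_ideal M \<Longrightarrow> y * x \<in> monomial_ideal M"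
    using keys_mult[of y x] assms
    by (force simp: monomial_ideal_def add_closed_def add.commute)
qed (simp add: monomial_ideal_def)

lemma monomial_ideal_subset_ideal:
  fixes I :: "('m::comm_monoid_add \<Rightarrow>\<^sub>0 'k::field) set"
  assumes "ideal I ty" and mono: "\<And>k. k \<in> M \<Longrightarrow> Poly_Mapping.single k 1 \<in> I"
  shows "monomial_ideal M \<subseteq> I"
proof
  fix p :: "'m \<Rightarrow>\<^sub>0 'k" assume "p \<in> monomial_ideal M"
  then show "p \<in> I"
  proof (induction p rule: poly_mapping_induct)
    case (single_add p k)
    then have "p - Poly_Mapping.single k (lookup p k) \<in> I" "k \<in> M"
      unfolding monomial_ideal_def mem_Collect_eq keys_minus_single by auto
    moreover have "Poly_Mapping.single k (lookup p k) \<in> I"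
      using ideal_tyD(3)[OF assms(1) mono[OF \<open>k \<in> M\<close>], of "Poly_Mapping.single 0 (lookup p k)"]
      by (simp add: mult_single)
    ultimately have "(p - Poly_Mapping.single k (lookup p k)) + Poly_Mapping.single k (lookup p k) \<in> I"
      using ideal_tyD(2)[OF assms(1)] by blast
    then show ?case by simp
  qed (use ideal_tyD(1)[OF assms(1)] in simp)
qed

text \<open>Multiplying monomials adds exponents, so ideal products become sums of exponent sets.
  This is what makes powers of the edge ideal combinatorial.\<close>

lemma ideal_prod_monomial_ideal:
  fixes A B :: "'m::comm_monoid_add set"
  assumes "add_closed A" "add_closed B"
  shows "ideal_prod ty (monomial_ideal A :: ('m \<Rightarrow>\<^sub>0 'k::field) set) (monomial_ideal B)
    = monomial_ideal {a + b | a b. a \<in> A \<and> b \<in> B}" (is "?l = monomial_ideal ?S")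
proof
  interpret R: cring "ty :: ('m \<Rightarrow>\<^sub>0 'k) ring" by (rule cring_from_type_algebra)
  have id: "ideal ?l ty"
    by (rule R.ideal_prod_is_ideal) (use assms ideal_monomial_ideal in auto)
  show "monomial_ideal ?S \<subseteq> ?l"
  proof (rule monomial_ideal_subset_ideal[OF id])
    fix k assume "k \<in> ?S"
    then obtain a b where "k = a + b" "a \<in> A" "b \<in> B" by auto
    then show "Poly_Mapping.single k 1 \<in> ?l"
      using ideal_prod.prod[of "Poly_Mapping.single a 1" "monomial_ideal A"
          "Poly_Mapping.single b 1" "monomial_ideal B" "ty :: ('m \<Rightarrow>\<^sub>0 'k) ring"]
      by (simp add: monomial_ideal_def mult_single)
  qed
  show "?l \<subseteq> monomial_ideal ?S"
  proof
    fix p assume "p \<in> ?l"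
    then show "p \<in> monomial_ideal ?S"
    proof induction
      case (prod i j)
      then show ?case using keys_mult[of i j] by (fastforce simp: monomial_ideal_def)
    next
      case (sum p q)
      then show ?case using keys_add[of p q] by (auto simp: monomial_ideal_def)
    qed
  qed
qed

section \<open>Associated primes of monomial ideals\<close>

text \<open>Exponents indexed by \<open>nat\<close> carry the lexicographic order, which serves as the monomial order.\<close>

definition nat_indexed :: "('v::finite \<Rightarrow>\<^sub>0 nat) \<Rightarrow> nat \<Rightarrow>\<^sub>0 nat" where
  "nat_indexed k = (\<Sum>v\<in>UNIV. Poly_Mapping.single (to_nat_on UNIV v) (lookup k v))"

lemma nat_indexed_add: "nat_indexed (k + l) = nat_indexed k + nat_indexed l"
  by (simp add: nat_indexed_def lookup_add single_add sum.distrib)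

lemma nat_indexed_inj: "nat_indexed k = nat_indexed l \<longleftrightarrow> k = l"
proof -
  have "lookup (nat_indexed k) (to_nat_on UNIV v) = lookup k v" for k and v :: "'v::finite"
  proof -
    have "lookup (nat_indexed k) (to_nat_on UNIV v) = (\<Sum>w\<in>UNIV. lookup k w when w = v)"
      unfolding nat_indexed_def lookup_sum
      by (intro sum.cong refl) (auto simp: lookup_single when_def to_nat_on_inj countable_finite)
    also have "\<dots> = lookup k v" by (simp add: when_def)
    finally show ?thesis .
  qed
  then show ?thesis by (metis poly_mapping_eqI)
qed

definition leading :: "(('v::finite \<Rightarrow>\<^sub>0 nat) \<Rightarrow>\<^sub>0 'k::field) \<Rightarrow> ('v \<Rightarrow>\<^sub>0 nat) \<Rightarrow> bool" where
  "leading p k \<longleftrightarrow> k \<in> keys p \<and> (\<forall>l\<in>keys p. nat_indexed l \<le> nat_indexed k)"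

lemma leading_exists:
  assumes "p \<noteq> 0" obtains k where "leading p k"
proof -
  have "Max (nat_indexed ` keys p) \<in> nat_indexed ` keys p"
    using assms by (intro Max_in) auto
  then obtain k where "k \<in> keys p" "Max (nat_indexed ` keys p) = nat_indexed k" by auto
  then show ?thesis using that[of k] by (metis Max_ge finite_imageI finite_keys imageI leading_def)
qed

text \<open>The order is compatible with addition, so only the pair of leading exponents reaches
  \<open>k + l\<close>; its coefficient is a product of two nonzero field elements.\<close>

lemma leading_mult:
  assumes p: "leading p k" and q: "leading q l"
  shows "k + l \<in> keys (p * q)"
proof -
  have uniq: "a = k \<and> b = l" if "a \<in> keys p" "b \<in> keys q" "k + l = a + b" for a b
  proof -
    have "nat_indexed a \<le> nat_indexed k" "nat_indexed b \<le> nat_indexed l"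
      using that p q by (auto simp: leading_def)
    moreover have "nat_indexed k + nat_indexed l = nat_indexed a + nat_indexed b"
      using that(3) by (metis nat_indexed_add)
    ultimately have "nat_indexed a = nat_indexed k" 
      by (metis add_less_le_mono antisym_conv2 less_irrefl)
    then show ?thesis using that(3) by (simp add: nat_indexed_inj)
  qed
  have "lookup (p * q) (k + l) = (\<Sum>(a, b) \<in> keys p \<times> keys q. lookup p a * lookup q b when k + l = a + b)"
  proof -
    have fin: "finite (keys p \<times> keys q)" by simp
    have "lookup (p * q) (k + l) = prod_fun (lookup p) (lookup q) (k + l)"
      by (simp add: times_poly_mapping.rep_eq)
    also have "\<dots> = (\<Sum>(a, b). lookup p a * lookup q b when k + l = a + b)"
      by (rule prod_fun_unfold_prod) auto
    also have "\<dots> = (\<Sum>(a, b) \<in> keys p \<times> keys q. lookup p a * lookup q b when k + l = a + b)"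
      by (rule Sum_any.expand_superset[OF fin]) (auto simp: in_keys_iff)
    finally show ?thesis .
  qed
  also have "\<dots> = (\<Sum>(a, b) \<in> {(k, l)}. lookup p a * lookup q b when k + l = a + b)"
    by (rule sum.mono_neutral_right) (use p q in \<open>auto simp: leading_def when_def split: if_splits dest: uniq\<close>)
  also have "\<dots> = lookup p k * lookup q l" by simp
  finally show ?thesis using p q by (simp add: leading_def in_keys_iff)
qed

text \<open>
  Modulo the monomial ideal, multiplying \<open>g\<close> by the leading monomial of \<open>p\<close> removes the leading term
  of \<open>g\<close>.
\<close>

lemma leading_power_annihilates:
  fixes g :: "('v::finite \<Rightarrow>\<^sub>0 nat) \<Rightarrow>\<^sub>0 'k::field"
  assumes M: "add_closed M" and p: "leading p k" and "p * g \<in> monomial_ideal M"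
  shows "\<exists>n. Poly_Mapping.single k 1 ^ n * g \<in> monomial_ideal M"
  using assms(3)
proof (induction "card (keys g)" arbitrary: g rule: less_induct)
  case less
  note J = ideal_tyD[OF ideal_monomial_ideal[OF M, where 'k = 'k]]
  let ?m = "Poly_Mapping.single k (1::'k)"
  show ?case
  proof (cases "g = 0")
    case True then show ?thesis by (simp add: monomial_ideal_def)
  next
    case False
    then obtain l where l: "leading g l" by (rule leading_exists)
    let ?s = "Poly_Mapping.single l (lookup g l)"
    \<comment> \<open>The leading terms do not cancel in \<open>p * g\<close>, whose whole support
      lies in \<open>M\<close>.\<close>
    have kl: "k + l \<in> M"
      using leading_mult[OF p l] less.prems by (auto simp: monomial_ideal_def)
    have ms: "?m * ?s \<in> monomial_ideal M"
      using kl by (auto simp: mult_single monomial_ideal_def)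
    have "?m * (p * g) - p * (?m * ?s) \<in> monomial_ideal M"
      by (rule J(4)[OF J(3)[OF less.prems] J(3)[OF ms]])
    then have *: "p * (?m * (g - ?s)) \<in> monomial_ideal M" by (simp add: algebra_simps)
    have "keys (?m * (g - ?s)) \<subseteq> (\<lambda>a. k + a) ` keys (g - ?s)"
      using keys_mult[of ?m "g - ?s"] by auto
    then have "card (keys (?m * (g - ?s))) \<le> card (keys (g - ?s))"
      using surj_card_le finite_keys by blast
    also have "\<dots> < card (keys g)"
      unfolding keys_minus_single using l by (intro psubset_card_mono) (auto simp: leading_def)
    finally obtain n where "?m ^ n * (?m * (g - ?s)) \<in> monomial_ideal M"
      using less.hyps * by blast
    from J(2)[OF this J(3)[OF ms, of "?m ^ n"]]
    have "?m ^ Suc n * g \<in> monomial_ideal M" by (simp add: algebra_simps)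
    then show ?thesis by blast
  qed
qed

lemma prime_power_ty:
  assumes "primeideal P ty" "x ^ n \<in> P"
  shows "(x :: 'a::comm_ring_1) \<in> P"
  using assms(2) primeideal_tyD(2,3)[OF assms(1)] by (induction n) auto

text \<open>If \<open>p\<close> kills \<open>g\<close> modulo the ideal, so does a power of the
  leading monomial of \<open>p\<close>, hence by primality that monomial itself. Subtracting the
  leading term and repeating reaches every monomial of \<open>p\<close>.\<close>

lemma prime_colon_monomial:
  fixes g :: "('v::finite \<Rightarrow>\<^sub>0 nat) \<Rightarrow>\<^sub>0 'k::field"
  assumes M: "add_closed M" and prime: "primeideal {r. r * g \<in> monomial_ideal M} ty"
  shows "{r. r * g \<in> monomial_ideal M} = monomial_ideal {k. Poly_Mapping.single k 1 * g \<in> monomial_ideal M}"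
    (is "?P = monomial_ideal ?Q")
proof
  note P = primeideal_tyD[OF prime]
  show "monomial_ideal ?Q \<subseteq> ?P"
    by (rule monomial_ideal_subset_ideal[OF P(1)]) simp
  show "?P \<subseteq> monomial_ideal ?Q"
  proof
    fix p assume "p \<in> ?P"
    then show "p \<in> monomial_ideal ?Q"
    proof (induction "card (keys p)" arbitrary: p rule: less_induct)
      case less
      show ?case
      proof (cases "p = 0")
        case True then show ?thesis by (simp add: monomial_ideal_def)
      next
        case False
        then obtain k where k: "leading p k" by (rule leading_exists)
        obtain n where "Poly_Mapping.single k 1 ^ n * g \<in> monomial_ideal M"
          using leading_power_annihilates[OF M k] less.prems by auto
        then have m: "Poly_Mapping.single k 1 \<in> ?P" using prime_power_ty[OF prime] by blast
        have "Poly_Mapping.single k (lookup p k) \<in> ?P"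
          using ideal_tyD(3)[OF P(1) m, of "Poly_Mapping.single 0 (lookup p k)"]
          by (simp add: mult_single)
        then have "p - Poly_Mapping.single k (lookup p k) \<in> ?P"
          by (intro ideal_tyD(4)[OF P(1)] less.prems)
        moreover have "card (keys (p - Poly_Mapping.single k (lookup p k))) < card (keys p)"
          unfolding keys_minus_single using k by (intro psubset_card_mono) (auto simp: leading_def)
        ultimately have "p - Poly_Mapping.single k (lookup p k) \<in> monomial_ideal ?Q"
          using less.hyps by blast
        with m show ?thesis unfolding monomial_ideal_def mem_Collect_eq keys_minus_single by blast
      qed
    qed
  qed
qed

text \<open>The exponents of monomials divisible by a variable from \<open>U\<close>; they span the
  ideal generated by these variables.\<close>

definition meets :: "'v set \<Rightarrow> ('v \<Rightarrow>\<^sub>0 nat) set" where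
  "meets U = {k. keys k \<inter> U \<noteq> {}}"

lemma add_keys_nat: "keys (k + l) = keys k \<union> keys (l :: 'v \<Rightarrow>\<^sub>0 nat)"
  by (auto simp: in_keys_iff lookup_add)

text \<open>A monomial is a product of variables, and primality splits them off one at a time, by
  induction on the degree, until one of them lies in \<open>P\<close>.\<close>

lemma prime_monomials:
  fixes P :: "('v, 'k::field) mpoly set"
  assumes prime: "primeideal P ty"
  shows "{k. Poly_Mapping.single k 1 \<in> P} = meets {v. var v \<in> P}"
proof -
  note P = primeideal_tyD[OF prime]
  have *: "Poly_Mapping.single (Poly_Mapping.single v 1 + l) 1 = var v * Poly_Mapping.single l (1::'k)" for v l
    by (simp add: var_def mult_single)
  have ex: "\<exists>l. k = Poly_Mapping.single v 1 + l" if "v \<in> keys k" for v and k :: "'v \<Rightarrow>\<^sub>0 nat"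
  proof
    show "k = Poly_Mapping.single v 1 + (k - Poly_Mapping.single v 1)"
      using that by (intro poly_mapping_eqI)
        (auto simp: lookup_add lookup_minus lookup_single when_def in_keys_iff)
  qed
  have "Poly_Mapping.single k 1 \<in> P \<Longrightarrow> k \<in> meets {v. var v \<in> P}" for k
  proof (induction "\<Sum>v\<in>keys k. lookup k v" arbitrary: k rule: less_induct)
    case less
    show ?case
    proof (cases "k = 0")
      case True then show ?thesis using less.prems P(2) by simp
    next
      case False
      then obtain v where v: "v \<in> keys k"
        by (metis all_not_in_conv in_keys_iff lookup_zero poly_mapping_eqI)
      with ex obtain l where kl: "k = Poly_Mapping.single v 1 + l" by blast
      have "(\<Sum>v\<in>keys l. lookup l v) \<le> (\<Sum>v\<in>keys k. lookup l v)"
        unfolding kl add_keys_nat by (rule sum_mono2) auto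
      also have "\<dots> < (\<Sum>v\<in>keys k. lookup k v)"
        by (rule sum_strict_mono_ex1)
          (use v in \<open>auto simp: kl lookup_add intro!: bexI[of _ v]\<close>)
      finally have IH: "Poly_Mapping.single l 1 \<in> P \<Longrightarrow> l \<in> meets {v. var v \<in> P}" by (rule less.hyps)
      have "var v \<in> P \<or> Poly_Mapping.single l 1 \<in> P" using less.prems P(3) * kl by metis
      then show ?thesis using IH v by (auto simp: meets_def kl add_keys_nat)
    qed
  qed
  moreover have "Poly_Mapping.single k 1 \<in> P" if k: "k \<in> meets {v. var v \<in> P}" for k
  proof -
    obtain v where v: "v \<in> keys k" "var v \<in> P" using k by (auto simp: meets_def)
    then obtain l where "k = Poly_Mapping.single v 1 + l" using ex by blast
    then show ?thesis using * ideal_tyD(3)[OF P(1) v(2)] by (metis mult.commute)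
  qed
  ultimately show ?thesis by blast
qed

lemma keys_single_mult:
  fixes g :: "('m::cancel_comm_monoid_add) \<Rightarrow>\<^sub>0 'k::field"
  shows "keys (Poly_Mapping.single k 1 * g) = (\<lambda>c. k + c) ` keys g"
proof
  show "keys (Poly_Mapping.single k 1 * g) \<subseteq> (\<lambda>c. k + c) ` keys g"
    using keys_mult[of "Poly_Mapping.single k 1" g] by auto
  have "lookup (Poly_Mapping.single k 1 * g) (k + c) = lookup g c" for c
    by (simp add: lookup_mult lookup_single when_mult)
  then show "(\<lambda>c. k + c) ` keys g \<subseteq> keys (Poly_Mapping.single k 1 * g)"
    by (auto simp: in_keys_iff)
qed

text \<open>Otherwise every monomial of \<open>g\<close> is pushed into \<open>M\<close> by some
  monomial outside the prime. The product of these multipliers kills all of \<open>g\<close> but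
  contains no variable from \<open>U\<close>, a contradiction; so one monomial of \<open>g\<close>
  has the same annihilator as \<open>g\<close>.\<close>

lemma Ass_monomial_idealD:
  fixes P :: "('v::finite, 'k::field) mpoly set"
  assumes M: "add_closed M" and P: "P \<in> Ass ty (monomial_ideal M)"
  shows "\<exists>U h. P = monomial_ideal (meets U) \<and> (\<forall>k. k + h \<in> M \<longleftrightarrow> k \<in> meets U)"
proof -
  obtain g where prime: "primeideal P ty" and g: "P = {r. r * g \<in> monomial_ideal M}"
    using P Ass_ty_iff[OF ideal_monomial_ideal[OF M]] by blast
  let ?U = "{v. var v \<in> P}"
  have Q: "Poly_Mapping.single k 1 \<in> P \<longleftrightarrow> k \<in> meets ?U" for k
    using prime_monomials[OF prime] by blast
  have PQ: "P = monomial_ideal (meets ?U)"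
  proof -
    have "P = monomial_ideal {k. Poly_Mapping.single k 1 \<in> P}"
      using prime_colon_monomial[OF M, of g] prime unfolding g mem_Collect_eq .
    then show ?thesis unfolding prime_monomials[OF prime] .
  qed
  have mono: "Poly_Mapping.single k 1 \<in> P \<longleftrightarrow> (\<forall>c\<in>keys g. k + c \<in> M)" for k
    by (auto simp: g monomial_ideal_def keys_single_mult)
  have "\<exists>h\<in>keys g. \<forall>k. k + h \<in> M \<longrightarrow> k \<in> meets ?U"
  proof (rule ccontr)
    assume "\<not> ?thesis"
    then obtain f where f: "\<And>c. c \<in> keys g \<Longrightarrow> f c + c \<in> M \<and> f c \<notin> meets ?U" by metis
    have "(\<Sum>c\<in>F. f c) \<notin> meets ?U" if "F \<subseteq> keys g" for F
    proof -
      have "finite F" using that by (rule finite_subset) simp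
      then show ?thesis using that
        by (induction F) (use f in \<open>auto simp: meets_def add_keys_nat\<close>)
    qed
    moreover have "(\<Sum>c\<in>keys g. f c) + c \<in> M" if "c \<in> keys g" for c
    proof -
      have "(f c + c) + (\<Sum>c\<in>keys g - {c}. f c) \<in> M"
        using M f[OF that] by (auto simp: add_closed_def)
      then show ?thesis using that by (simp add: sum.remove[of _ c] ac_simps)
    qed
    ultimately show False using mono Q by blast
  qed
  then show ?thesis using PQ mono Q by metis
qed

lemma Ass_monomial_idealI:
  fixes h :: "'v::finite \<Rightarrow>\<^sub>0 nat"
  assumes M: "add_closed M" and "primeideal (monomial_ideal Q :: ('v, 'k::field) mpoly set) ty"
    and h: "\<And>k. k + h \<in> M \<longleftrightarrow> k \<in> Q"
  shows "(monomial_ideal Q :: ('v, 'k) mpoly set) \<in> Ass ty (monomial_ideal M)"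
proof -
  have "monomial_ideal Q = {r :: ('v, 'k) mpoly. r * Poly_Mapping.single h 1 \<in> monomial_ideal M}"
    using h by (auto simp: monomial_ideal_def keys_single_mult mult.commute[of _ "Poly_Mapping.single h 1"] add.commute)
  then show ?thesis using Ass_ty_iff[OF ideal_monomial_ideal[OF M]] assms(2) by blast
qed

section \<open>The ideal generated by all variables\<close>

lemma max_ideal_eq: "(max_ideal :: ('v::finite, 'k::field) mpoly set) = monomial_ideal (meets UNIV)"
proof -
  interpret R: cring "ty :: ('v, 'k) mpoly ring" by (rule cring_from_type_algebra)
  have ac: "add_closed (meets UNIV :: ('v \<Rightarrow>\<^sub>0 nat) set)"
    by (auto simp: add_closed_def meets_def add_keys_nat simp del: keys_eq_empty)
  have id: "ideal (max_ideal :: ('v, 'k) mpoly set) ty"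
    unfolding max_ideal_def by (rule R.genideal_ideal) simp
  have sub: "range var \<subseteq> (max_ideal :: ('v, 'k) mpoly set)"
    unfolding max_ideal_def by (rule R.genideal_self) simp
  show ?thesis
  proof
    show "(max_ideal :: ('v, 'k) mpoly set) \<subseteq> monomial_ideal (meets UNIV)"
      unfolding max_ideal_def
      by (rule R.genideal_minimal[OF ideal_monomial_ideal[OF ac]])
        (auto simp: monomial_ideal_def var_def meets_def simp del: keys_eq_empty)
    show "monomial_ideal (meets UNIV) \<subseteq> (max_ideal :: ('v, 'k) mpoly set)"
    proof (rule monomial_ideal_subset_ideal[OF id])
      fix k :: "'v \<Rightarrow>\<^sub>0 nat" assume "k \<in> meets UNIV"
      then obtain v where v: "v \<in> keys k" unfolding meets_def by blast
      have "k = (k - Poly_Mapping.single v 1) + Poly_Mapping.single v 1"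
        using v by (intro poly_mapping_eqI)
          (auto simp: lookup_add lookup_minus lookup_single when_def in_keys_iff)
      then have "Poly_Mapping.single k 1 = Poly_Mapping.single (k - Poly_Mapping.single v 1) (1::'k) * var v"
        by (metis mult_single mult_1 var_def)
      then show "Poly_Mapping.single k 1 \<in> (max_ideal :: ('v, 'k) mpoly set)"
        using ideal_tyD(3)[OF id] sub by (simp add: image_subset_iff)
    qed
  qed
qed

text \<open>These are the polynomials without constant term, and the constant coefficient is
  multiplicative because exponents cannot cancel.\<close>

lemma primeideal_max_ideal: "primeideal (max_ideal :: ('v::finite, 'k::field) mpoly set) ty"
proof -
  have z: "meets UNIV = - {0 :: 'v \<Rightarrow>\<^sub>0 nat}"
    by (auto simp: meets_def)
  have 1: "max_ideal = {p :: ('v, 'k) mpoly. lookup p 0 = 0}"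
    unfolding max_ideal_eq monomial_ideal_def z by (auto simp: in_keys_iff)
  have 2: "lookup (p * q) 0 = lookup p 0 * lookup q 0" for p q :: "('v, 'k) mpoly"
  proof -
    have z: "0 = l + q \<longleftrightarrow> l = 0 \<and> q = 0" for l q :: "'v \<Rightarrow>\<^sub>0 nat"
      by (metis Un_empty add.right_neutral add_keys_nat keys_eq_empty)
    have "lookup p l * (\<Sum>r. lookup q r when 0 = l + r) = (lookup p 0 * lookup q 0 when l = 0)" for l
      by (cases "l = 0") (auto simp: z)
    then show ?thesis by (simp add: lookup_mult)
  qed
  interpret R: cring "ty :: ('v, 'k) mpoly ring" by (rule cring_from_type_algebra)
  have id: "ideal (max_ideal :: ('v, 'k) mpoly set) ty"
    unfolding max_ideal_def by (rule R.genideal_ideal) simp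
  show ?thesis
  proof (rule primeidealI[OF id R.cring_axioms])
    show "carrier ty \<noteq> (max_ideal :: ('v, 'k) mpoly set)"
    proof
      assume "carrier ty = (max_ideal :: ('v, 'k) mpoly set)"
      then have "(1 :: ('v, 'k) mpoly) \<in> max_ideal" by auto
      then show False by (simp add: 1)
    qed
  next
    fix a b :: "('v, 'k) mpoly"
    assume "a \<otimes>\<^bsub>ty\<^esub> b \<in> max_ideal"
    then show "a \<in> max_ideal \<or> b \<in> max_ideal" by (simp add: 1 2)
  qed
qed

section \<open>Degree multisets of edge multisets\<close>

text \<open>\<open>b\<close> is the exponent vector of a product of \<open>t\<close> edge
  generators, written as a multiset of vertices. Edges are stored as ordered pairs, in either order,
  so that they can be directed later.\<close>

definition edge_sum :: "'v set set \<Rightarrow> nat \<Rightarrow> 'v multiset \<Rightarrow> bool" where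
  "edge_sum E t b \<longleftrightarrow> (\<exists>N. size N = t \<and> (\<forall>(x, y)\<in>#N. {x, y} \<in> E) \<and>
     b = image_mset fst N + image_mset snd N)"

text \<open>With \<open>h\<close> read as a monomial, this is membership in the \<open>t\<close>-th
  power of the edge ideal.\<close>

definition has_edges :: "'v set set \<Rightarrow> nat \<Rightarrow> 'v multiset \<Rightarrow> bool" where
  "has_edges E t h \<longleftrightarrow> (\<exists>b. edge_sum E t b \<and> b \<subseteq># h)"

lemma edge_sum_0: "edge_sum E 0 {#}"
  by (auto simp: edge_sum_def)

lemma edge_sum_add:
  assumes "edge_sum E s a" "edge_sum E t b"
  shows "edge_sum E (s + t) (a + b)"
proof -
  obtain M N where "size M = s" "\<forall>(x, y)\<in>#M. {x, y} \<in> E" "a = image_mset fst M + image_mset snd M"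
    "size N = t" "\<forall>(x, y)\<in>#N. {x, y} \<in> E" "b = image_mset fst N + image_mset snd N"
    using assms unfolding edge_sum_def by blast
  then show ?thesis unfolding edge_sum_def by (intro exI[of _ "M + N"]) auto
qed

lemma edge_sum_edge: "{x, y} \<in> E \<Longrightarrow> edge_sum E 1 {#x, y#}"
  unfolding edge_sum_def by (intro exI[of _ "{#(x, y)#}"]) auto

lemma edge_sum_size: "edge_sum E t b \<Longrightarrow> size b = 2 * t"
  by (auto simp: edge_sum_def)

lemma edge_sum_mono: "edge_sum E t b \<Longrightarrow> E \<subseteq> F \<Longrightarrow> edge_sum F t b"
  unfolding edge_sum_def by fast

lemma has_edges_mono:
  assumes "has_edges E t h" "s \<le> t" "h \<subseteq># h'" "E \<subseteq> F"
  shows "has_edges F s h'"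
proof -
  obtain N where N: "size N = t" "\<forall>(x, y)\<in>#N. {x, y} \<in> E" "image_mset fst N + image_mset snd N \<subseteq># h"
    using assms(1) unfolding has_edges_def edge_sum_def by blast
  obtain M where M: "M \<subseteq># N" "size M = s"
  proof -
    obtain xs where xs: "mset xs = N" using ex_mset by blast
    show ?thesis
    proof
      show "mset (take s xs) \<subseteq># N"
        by (metis append_take_drop_id mset_append mset_subset_eq_add_left xs)
      show "size (mset (take s xs)) = s" using xs N(1) assms(2) by auto
    qed
  qed
  have "image_mset fst M + image_mset snd M \<subseteq># h'"
    using subset_mset.add_mono[OF image_mset_subseteq_mono[OF M(1), of fst] image_mset_subseteq_mono[OF M(1), of snd]]
      N(3) assms(3) by (meson subset_mset.order_trans)
  then show ?thesis
    unfolding has_edges_def edge_sum_def using M N(2) assms(4) mset_subset_eqD[OF M(1)]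
    by (intro exI conjI) fast+
qed

lemma has_edges_add:
  "has_edges E s a \<Longrightarrow> has_edges E t b \<Longrightarrow> has_edges E (s + t) (a + b)"
  unfolding has_edges_def using edge_sum_add subset_mset.add_mono by fast

lemma has_edges_Suc:
  "has_edges E (Suc t) h \<longleftrightarrow> (\<exists>x y h'. {x, y} \<in> E \<and> has_edges E t h' \<and> h = h' + {#x, y#})"
proof
  assume "has_edges E (Suc t) h"
  then obtain N where N: "size N = Suc t" "\<forall>(x, y)\<in>#N. {x, y} \<in> E"
    "image_mset fst N + image_mset snd N \<subseteq># h"
    unfolding has_edges_def edge_sum_def by blast
  then obtain x y M where M: "N = add_mset (x, y) M" by (metis size_eq_Suc_imp_eq_union surj_pair)
  let ?b = "image_mset fst M + image_mset snd M"
  obtain d where d: "h = image_mset fst N + image_mset snd N + d"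
    using N(3) by (metis subset_mset.le_iff_add)
  have "has_edges E t (?b + d)"
    unfolding has_edges_def edge_sum_def using N M
    by (intro exI[of _ ?b] conjI exI[of _ M]) auto
  then show "\<exists>x y h'. {x, y} \<in> E \<and> has_edges E t h' \<and> h = h' + {#x, y#}"
    using N(2) M d by (intro exI[of _ x] exI[of _ y] exI[of _ "?b + d"]) auto
next
  assume "\<exists>x y h'. {x, y} \<in> E \<and> has_edges E t h' \<and> h = h' + {#x, y#}"
  then obtain x y h' where *: "{x, y} \<in> E" "has_edges E t h'" "h = h' + {#x, y#}" by blast
  have "has_edges E 1 {#x, y#}"
    unfolding has_edges_def using edge_sum_edge[OF *(1)] by blast
  from has_edges_add[OF *(2) this] show "has_edges E (Suc t) h" using *(3) by simp
qed

abbreviation path :: "'v set set \<Rightarrow> 'v list \<Rightarrow> bool" where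
  "path E \<equiv> successively (\<lambda>x y. {x, y} \<in> E)"

text \<open>Every second edge of the path, beginning with the first, covers each list entry exactly
  once.\<close>

lemma edge_sum_path:
  "path E q \<Longrightarrow> even (length q) \<Longrightarrow> edge_sum E (length q div 2) (mset q)"
proof (induction q rule: induct_list012)
  case (3 x y zs)
  then have "edge_sum E (length zs div 2) (mset zs)" "{x, y} \<in> E"
    by (auto simp: successively_Cons)
  from edge_sum_add[OF this(1) edge_sum_edge[OF this(2)]] show ?case by simp
qed (auto simp: edge_sum_0)

section \<open>Balanced splitting of bipartite multigraphs\<close>

text \<open>Outdegree minus indegree at \<open>v\<close>, with \<open>(x, y)\<close> directed from
  \<open>x\<close> to \<open>y\<close>; a loop contributes zero.\<close>

definition excess :: "('v \<times> 'v) multiset \<Rightarrow> 'v \<Rightarrow> int" where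
  "excess N v = (\<Sum>(x, y)\<in>#N. of_bool (x = v) - of_bool (y = v))"

lemma excess_simps [simp]:
  "excess {#} v = 0"
  "excess (add_mset (x, y) N) v = of_bool (x = v) - of_bool (y = v) + excess N v"
  "excess (M + N) v = excess M v + excess N v"
  by (auto simp: excess_def)

lemma excess_eq: "excess N v = int (count (image_mset fst N) v) - int (count (image_mset snd N) v)"
  by (induction N) auto

lemma excess_eq_0:
  assumes "\<forall>(x, y)\<in>#N. x \<noteq> v \<and> y \<noteq> v"
  shows "excess N v = 0"
  using assms by (induction N) auto

text \<open>
  The edges in the second part are traversed against their given direction, so this is an
  orientation with indegrees and outdegrees differing by at most one. Two edges at a common
  vertex can be spliced into one.
\<close>

lemma balanced_orientation:
  "\<exists>S T. N = S + T \<and> (\<forall>v. \<bar>excess S v - excess T v\<bar> \<le> 1)"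
proof (induction "size N" arbitrary: N rule: less_induct)
  case less
  consider (loop) x M where "N = add_mset (x, x) M"
    | (splice) x y z p q M where "N = add_mset p (add_mset q M)"
        "p = (x, y) \<or> p = (y, x)" "q = (x, z) \<or> q = (z, x)"
    | (disjoint) "\<And>x M. N \<noteq> add_mset (x, x) M"
        "\<And>x y z p q M. N = add_mset p (add_mset q M) \<Longrightarrow>
          p = (x, y) \<or> p = (y, x) \<Longrightarrow> \<not> (q = (x, z) \<or> q = (z, x))"
    by metis
  then show ?case
  proof cases
    case loop
    then obtain S T where "M = S + T" "\<forall>v. \<bar>excess S v - excess T v\<bar> \<le> 1"
      using less[of M] by auto
    with loop show ?thesis by (intro exI[of _ "add_mset (x, x) S"] exI[of _ T]) auto
  next
    case splice
    have "size (add_mset (z, y) M) < size N" by (simp add: splice)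
    then obtain S T where XY: "add_mset (z, y) M = S + T" "\<forall>v. \<bar>excess S v - excess T v\<bar> \<le> 1"
      using less by blast
    have "(z, y) \<in># S + T" unfolding XY(1)[symmetric] by simp
    then consider S' where "S = add_mset (z, y) S'" | T' where "T = add_mset (z, y) T'"
      by (metis union_iff mset_add)
    then show ?thesis
    proof cases
      case 1
      then have "M = S' + T" using XY(1) by simp
      have b: "\<bar>of_bool (z = v) - of_bool (y = v) + excess S' v - excess T v\<bar> \<le> 1" for v
        using XY(2) 1 by simp
      \<comment> \<open>\<open>(z, y)\<close> is replaced by the route from \<open>z\<close> through
        \<open>x\<close> to \<open>y\<close>. An edge goes into the second part when the route runs
        against its stored direction, and the passage through \<open>x\<close> contributes nothing
        there.\<close>
      let ?S = "S' + (if p = (x, y) then {#p#} else {#}) + (if q = (z, x) then {#q#} else {#})"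
      let ?T = "T + (if p = (x, y) then {#} else {#p#}) + (if q = (z, x) then {#} else {#q#})"
      have "N = ?S + ?T" using splice(1) \<open>M = S' + T\<close> by auto
      moreover have "excess ?S v - excess ?T v =
          of_bool (z = v) - of_bool (y = v) + excess S' v - excess T v" for v
        using splice(2,3) by auto
      ultimately show ?thesis using b by metis
    next
      case 2
      then have "M = S + T'" using XY(1) by simp
      have b: "\<bar>excess S v - (of_bool (z = v) - of_bool (y = v) + excess T' v)\<bar> \<le> 1" for v
        using XY(2) 2 by simp
      let ?T = "T' + (if p = (x, y) then {#p#} else {#}) + (if q = (z, x) then {#q#} else {#})"
      let ?S = "S + (if p = (x, y) then {#} else {#p#}) + (if q = (z, x) then {#} else {#q#})"
      have "N = ?S + ?T" using splice(1) \<open>M = S + T'\<close> by auto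
      moreover have "excess ?S v - excess ?T v =
          excess S v - (of_bool (z = v) - of_bool (y = v) + excess T' v)" for v
        using splice(2,3) by auto
      ultimately show ?thesis using b by metis
    qed
  next
    case disjoint
    \<comment> \<open>Every vertex now meets at most one edge, so all edges may keep their
      direction.\<close>
    have "\<bar>excess N v\<bar> \<le> 1" for v
    proof (cases "\<forall>(x, y)\<in>#N. x \<noteq> v \<and> y \<noteq> v")
      case True
      then show ?thesis using excess_eq_0 by force
    next
      case False
      then obtain x y where xy: "(x, y) \<in># N" "x = v \<or> y = v" by auto
      then obtain M where M: "N = add_mset (x, y) M" by (metis mset_add)
      have "\<forall>(a, b)\<in>#M. a \<noteq> v \<and> b \<noteq> v"
      proof safe
        fix b assume "(v, b) \<in># M"
        then obtain M' where "M = add_mset (v, b) M'" by (metis mset_add)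
        then show False using disjoint(2) M xy(2) by blast
      next
        fix b assume "(b, v) \<in># M"
        then obtain M' where "M = add_mset (b, v) M'" by (metis mset_add)
        then show False using disjoint(2) M xy(2) by blast
      qed
      then have "excess M v = 0" by (rule excess_eq_0)
      then show ?thesis using M by simp
    qed
    then show ?thesis by (intro exI[of _ N] exI[of _ "{#}"]) auto
  qed
qed

text \<open>All pairs run from \<open>A\<close> to \<open>B\<close>, so up to sign excess is degree,
  and the degrees in the two parts differ by at most one at each vertex. As they add up to at most
  \<open>2 * count h v\<close>, neither exceeds \<open>count h v\<close>; the larger part is
  taken.\<close>

lemma bipartite_halving:
  assumes Q: "\<forall>(x, y)\<in>#Q. x \<in> A \<and> y \<in> B" and "A \<inter> B = {}"
    and deg: "image_mset fst Q + image_mset snd Q \<subseteq># h + h"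
  shows "\<exists>S. S \<subseteq># Q \<and> size Q \<le> 2 * size S \<and> image_mset fst S + image_mset snd S \<subseteq># h"
proof -
  obtain S T where XY: "Q = S + T" "\<forall>v. \<bar>excess S v - excess T v\<bar> \<le> 1"
    using balanced_orientation by blast
  let ?d = "\<lambda>S. image_mset fst S + image_mset snd S"
  have "count (?d S) v \<le> count h v \<and> count (?d T) v \<le> count h v" for v
  proof -
    have d: "count (?d S) v + count (?d T) v \<le> 2 * count h v"
      using mset_subset_eq_count[OF deg, of v] unfolding XY(1) by simp
    have f: "count (image_mset fst M) v = 0" if "M \<subseteq># Q" "v \<notin> A" for M
      using Q that mset_subset_eqD[OF that(1)] by (fastforce simp: count_eq_zero_iff)
    have s: "count (image_mset snd M) v = 0" if "M \<subseteq># Q" "v \<notin> B" for M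
      using Q that mset_subset_eqD[OF that(1)] by (fastforce simp: count_eq_zero_iff)
    have sub: "S \<subseteq># Q" "T \<subseteq># Q" using XY by auto
    have b: "\<bar>excess S v - excess T v\<bar> \<le> 1" using XY by blast
    show ?thesis
    proof (cases "v \<in> A")
      case True
      then have "v \<notin> B" using assms(2) by blast
      then show ?thesis using d b s[OF sub(1)] s[OF sub(2)] unfolding excess_eq count_union by linarith
    next
      case False
      then show ?thesis using d b f[OF sub(1)] f[OF sub(2)] unfolding excess_eq count_union by linarith
    qed
  qed
  then have "?d S \<subseteq># h" "?d T \<subseteq># h" by (auto simp: mset_subset_eqI)
  moreover have "size Q \<le> 2 * size S \<or> size Q \<le> 2 * size T" using XY by auto
  ultimately show ?thesis using XY(1) by (metis mset_subset_eq_add_left mset_subset_eq_add_right)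
qed

text \<open>
  For a vertex v of K, the k + 1 edges fitting into h + v cover v by an edge vw. Removing it and
  adding the k + 1 edges fitting into h + w leaves 2k + 1 edges fitting into 2h, which are halved.
\<close>

lemma no_bipartite_part:
  assumes K: "\<And>e. e \<in> F \<Longrightarrow> e \<inter> K \<noteq> {} \<Longrightarrow> \<exists>a\<in>A. \<exists>b\<in>B. e = {a, b}"
    and AB: "A \<union> B = K" "A \<inter> B = {}" and v: "v \<in> K"
    and no: "\<not> has_edges F (Suc k) h"
    and yes: "\<And>v. v \<in> K \<Longrightarrow> has_edges F (Suc k) (add_mset v h)"
  shows False
proof -
  let ?d = "\<lambda>S. image_mset fst S + image_mset snd S"
  have no': "\<not> (?d N \<subseteq># h \<and> (\<forall>(x, y)\<in>#N. {x, y} \<in> F) \<and> size N > k)" for N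
  proof
    assume *: "?d N \<subseteq># h \<and> (\<forall>(x, y)\<in>#N. {x, y} \<in> F) \<and> size N > k"
    then have "has_edges F (size N) h" unfolding has_edges_def edge_sum_def by blast
    with * no show False using has_edges_mono[of F "size N" h "Suc k" h F] by auto
  qed
  have ex: "\<exists>N. size N = Suc k \<and> (\<forall>(x, y)\<in>#N. {x, y} \<in> F) \<and> ?d N \<subseteq># add_mset v h" if "v \<in> K" for v
    using yes[OF that] unfolding has_edges_def edge_sum_def by blast
  obtain N1 where N1: "size N1 = Suc k" "\<forall>(x, y)\<in>#N1. {x, y} \<in> F" "?d N1 \<subseteq># add_mset v h"
    using ex[OF v] by blast
  \<comment> \<open>If \<open>v\<close> were uncovered, these edges would already fit into
    \<open>h\<close>.\<close>
  have "v \<in># ?d N1"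
  proof (rule ccontr)
    assume "v \<notin># ?d N1"
    then have "count (?d N1) v = 0" by (simp only: not_in_iff)
    then have "count (?d N1) u \<le> count h u" for u
      using mset_subset_eq_count[OF N1(3), of u] by (cases "u = v") auto
    then have "?d N1 \<subseteq># h" by (rule mset_subset_eqI)
    then show False using no'[of N1] N1 by simp
  qed
  then obtain x y where xy: "(x, y) \<in># N1" "v = x \<or> v = y" by auto
  then obtain M1 where M1: "N1 = add_mset (x, y) M1" by (metis mset_add)
  define w where "w = (if v = x then y else x)"
  have dN1: "?d N1 = add_mset v (add_mset w (?d M1))" using xy(2) M1 by (auto simp: w_def)
  have "{v, w} \<in> F" using N1(2) xy by (auto simp: w_def insert_commute)
  with K[of "{v, w}"] v AB have w: "w \<in> K" by (auto simp: doubleton_eq_iff)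
  have d1: "add_mset w (?d M1) \<subseteq># h" using N1(3) dN1 by simp
  obtain M2 where M2: "size M2 = Suc k" "\<forall>(x, y)\<in>#M2. {x, y} \<in> F" "?d M2 \<subseteq># add_mset w h"
    using ex[OF w] by blast
  \<comment> \<open>Edges are sorted by whether they lie in the bipartite part; those inside are
    directed from \<open>A\<close> to \<open>B\<close>, as halving requires.\<close>
  define inK where "inK = (\<lambda>p :: 'a \<times> 'a. fst p \<in> K)"
  define P where "P M = filter_mset (\<lambda>p. \<not> inK p) M" for M
  define orient where "orient = (\<lambda>(x, y). if x \<in> A then (x, y) else (y, x :: 'a))"
  define Q where "Q M = image_mset orient (filter_mset inK M)" for M
  have M1F: "\<forall>(x, y)\<in>#M1. {x, y} \<in> F" using N1(2) M1 by auto
  have dQ: "?d (Q M) = ?d (filter_mset inK M)" for M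
  proof (induction M)
    case (add p M)
    then show ?case by (cases p) (auto simp: Q_def orient_def)
  qed (simp add: Q_def)
  have dPQ: "?d M = ?d (P M) + ?d (Q M)" for M
    unfolding dQ P_def by (induction M) (auto)
  have Q: "\<forall>(x, y)\<in>#Q M. x \<in> A \<and> y \<in> B \<and> {x, y} \<in> F" if "\<forall>(x, y)\<in>#M. {x, y} \<in> F" for M
  proof safe
    fix a b assume "(a, b) \<in># Q M"
    then obtain x y where xy: "(x, y) \<in># M" "x \<in> K" "(a, b) = orient (x, y)"
      by (auto simp: Q_def inK_def)
    then have "{x, y} \<in> F" using that by auto
    with K[of "{x, y}"] xy(2) obtain a' b' where "a' \<in> A" "b' \<in> B" "{x, y} = {a', b'}" by auto
    with AB(2) xy(3) \<open>{x, y} \<in> F\<close> show "a \<in> A" "b \<in> B" "{a, b} \<in> F"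
      by (auto simp: orient_def doubleton_eq_iff insert_commute split: if_splits)
  qed
  have P: "\<forall>(x, y)\<in>#P M. x \<notin> K \<and> y \<notin> K \<and> {x, y} \<in> F" if "\<forall>(x, y)\<in>#M. {x, y} \<in> F" for M
  proof safe
    fix x y assume xy: "(x, y) \<in># P M"
    then have F: "{x, y} \<in> F" "x \<notin> K" using that by (auto simp: P_def inK_def)
    then show "{x, y} \<in> F" "x \<in> K \<Longrightarrow> False" by auto
    show False if "y \<in> K"
      using K[OF F(1)] F(2) that AB(1) by (auto simp: doubleton_eq_iff)
  qed
  have sizePQ: "size M = size (P M) + size (Q M)" for M
    unfolding P_def Q_def by (induction M) auto
  have "add_mset w (?d M1 + ?d M2) \<subseteq># add_mset w (h + h)"
    using subset_mset.add_mono[OF d1 M2(3)] by simp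
  then have d12: "?d M1 + ?d M2 \<subseteq># h + h" by (simp add: add.assoc)
  have "?d (Q M1 + Q M2) \<subseteq># ?d M1 + ?d M2"
    unfolding dPQ[of M1] dPQ[of M2] by (simp add: ac_simps)
  with d12 have "?d (Q M1 + Q M2) \<subseteq># h + h" by (meson subset_mset.order_trans)
  then obtain S where S: "S \<subseteq># Q M1 + Q M2" "size (Q M1 + Q M2) \<le> 2 * size S" "?d S \<subseteq># h"
    using bipartite_halving[of "Q M1 + Q M2" A B h] Q[OF M1F] Q[OF M2(2)] AB(2) by fastforce
  \<comment> \<open>Halving acts only inside \<open>K\<close>; outside, the larger of the two edge
    collections is kept whole. This gives at least half of \<open>2 * k + 1\<close> edges, hence
    more than \<open>k\<close>.\<close>
  define M where "M = (if size (P M1) \<ge> size (P M2) then M1 else M2)"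
  have "size M1 + size M2 = Suc (2 * k)" using N1(1) M1 M2(1) by simp
  then have size: "size (S + P M) > k"
    using S(2) sizePQ[of M1] sizePQ[of M2] unfolding M_def by auto
  have MF: "\<forall>(x, y)\<in>#M. {x, y} \<in> F" using M1F M2(2) by (auto simp: M_def)
  have "count (?d (S + P M)) u \<le> count h u" for u
  proof (cases "u \<in> K")
    case True
    then have "count (?d (P M)) u = 0" using P[OF MF] by (fastforce simp: count_eq_zero_iff)
    then show ?thesis using mset_subset_eq_count[OF S(3), of u] by simp
  next
    case False
    have "count (?d S) u = 0"
      using False mset_subset_eqD[OF S(1)] Q[OF M1F] Q[OF M2(2)] AB(1)
      by (fastforce simp: count_eq_zero_iff)
    \<comment> \<open>\<open>w\<close> lies in \<open>K\<close>, so away from \<open>K\<close> both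
      collections fit into \<open>h\<close> as they stand.\<close>
    moreover have "count (?d M1) u \<le> count h u" "count (?d M2) u \<le> count h u"
      using mset_subset_eq_count[OF d1, of u] mset_subset_eq_count[OF M2(3), of u] False w
      by (auto split: if_splits)
    moreover have "count (?d M) u = count (?d (P M)) u + count (?d (Q M)) u"
      by (metis dPQ count_union)
    ultimately show ?thesis
      unfolding image_mset_union by (auto simp: M_def split: if_splits)
  qed
  then have "?d (S + P M) \<subseteq># h" by (rule mset_subset_eqI)
  moreover have "\<forall>(x, y)\<in>#S + P M. {x, y} \<in> F"
    using P[OF MF] mset_subset_eqD[OF S(1)] Q[OF M1F] Q[OF M2(2)] by fastforce
  ultimately show False using no' size by blast
qed

section \<open>Odd cycles\<close>

definition closed_walk :: "'v set set \<Rightarrow> 'v list \<Rightarrow> bool" where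
  "closed_walk E c \<longleftrightarrow> c \<noteq> [] \<and> path E c \<and> {last c, hd c} \<in> E"

lemma graph_cycle_iff:
  "graph_cycle E c \<longleftrightarrow> length c \<ge> 3 \<and> distinct c \<and> closed_walk E c"
proof -
  have "(\<forall>i<length c. {c ! i, c ! (Suc i mod length c)} \<in> E) \<longleftrightarrow>
      path E c \<and> {last c, hd c} \<in> E" if len: "length c \<ge> 3"
  proof -
    obtain n where n: "length c = Suc n" using len by (cases c) auto
    have "(\<forall>i<length c. {c ! i, c ! (Suc i mod length c)} \<in> E) \<longleftrightarrow>
        (\<forall>i<n. {c ! i, c ! (Suc i mod length c)} \<in> E) \<and> {c ! n, c ! (Suc n mod length c)} \<in> E"
      unfolding n by (auto simp: less_Suc_eq)
    also have "\<dots> \<longleftrightarrow> path E c \<and> {last c, hd c} \<in> E"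
    proof -
      have "c \<noteq> []" using n by auto
      then have "last c = c ! n" "hd c = c ! 0"
        using n by (simp_all add: last_conv_nth hd_conv_nth)
      then show ?thesis using n by (auto simp: successively_conv_nth)
    qed
    finally show ?thesis .
  qed
  then show ?thesis by (auto simp: graph_cycle_def closed_walk_def)
qed

text \<open>A repeated vertex cuts a closed walk into two shorter ones whose lengths add up, so one
  of them is odd. Length one would be a loop, so an odd closed walk without repetition is a
  cycle.\<close>

lemma odd_closed_walk_imp_odd_cycle:
  assumes "closed_walk E c" "odd (length c)" and card2: "\<And>e. e \<in> E \<Longrightarrow> card e = 2"
  shows "has_odd_cycle E"
  using assms(1,2)
proof (induction "length c" arbitrary: c rule: less_induct)
  case less
  show ?case
  proof (cases "distinct c")
    case True
    have "length c \<noteq> 1"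
    proof
      assume "length c = 1"
      then obtain x where "c = [x]" by (auto simp: length_Suc_conv)
      then show False using less.prems card2[of "{x}"] by (auto simp: closed_walk_def)
    qed
    with less.prems(2) have "length c \<ge> 3" by presburger
    with True less.prems show ?thesis by (auto simp: has_odd_cycle_def graph_cycle_iff)
  next
    case False
    then obtain xs ys zs x where c: "c = xs @ [x] @ ys @ [x] @ zs" using not_distinct_decomp by blast
    have 1: "closed_walk E (x # ys)" and 2: "closed_walk E (xs @ x # zs)"
      using less.prems(1) unfolding c closed_walk_def
      by (auto simp: successively_append_iff successively_Cons hd_append split: if_splits)
    show ?thesis
    proof (cases "odd (length (x # ys))")
      case True
      then show ?thesis using less.hyps[OF _ 1] c by simp
    next
      case False
      then show ?thesis using less.hyps[OF _ 2] less.prems(2) c by simp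
    qed
  qed
qed

section \<open>Two-colouring connected graphs without odd cycles\<close>

lemma simple_graph_edge:
  assumes "simple_graph V E" "e \<in> E" "a \<in> e"
  shows "\<exists>b. e = {a, b} \<and> a \<in> V \<and> b \<in> V"
proof -
  have "card e = 2" "e \<subseteq> V" using assms by (auto simp: simple_graph_def)
  then obtain x y where "e = {x, y}" by (auto simp: card_2_iff)
  then show ?thesis using assms(3) \<open>e \<subseteq> V\<close> by blast
qed

lemma adj_rtrancl_walk:
  assumes "(u, v) \<in> (adj E)\<^sup>*"
  shows "\<exists>w. w \<noteq> [] \<and> path E w \<and> hd w = u \<and> last w = v"
  using assms
proof (induction rule: rtrancl_induct)
  case base
  show ?case by (intro exI[of _ "[u]"]) auto
next
  case (step y z)
  then obtain w where "w \<noteq> []" "path E w" "hd w = u" "last w = y" by blast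
  with step(2) show ?case
    by (intro exI[of _ "w @ [z]"]) (auto simp: successively_append_iff adj_def)
qed

text \<open>Vertices are coloured by the parity of a walk from a fixed root.\<close>

lemma bipartite_if_no_odd_cycle:
  assumes "simple_graph V E" "connected_graph V E" "\<not> has_odd_cycle E"
  shows "bipartite_graph V E"
proof -
  obtain r where r: "r \<in> V" using assms(2) by (auto simp: connected_graph_def)
  define walk where "walk w v \<longleftrightarrow> w \<noteq> [] \<and> path E w \<and> hd w = r \<and> last w = v" for w v
  define A where "A = {v\<in>V. \<exists>w. walk w v \<and> odd (length w)}"
  have ex: "\<exists>w. walk w v" if "v \<in> V" for v
    using adj_rtrancl_walk[of r v E] assms(2) r that unfolding connected_graph_def walk_def by blast
  have parity: "even (length w1) \<noteq> even (length w2)" if w: "walk w1 a" "walk w2 b" "{a, b} \<in> E" for w1 w2 a b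
  proof (rule notI)
    assume eq: "even (length w1) = even (length w2)"
    \<comment> \<open>Out along \<open>w1\<close>, across the edge and back along \<open>w2\<close>;
      the final root is dropped because the closed walk starts with it. The length is therefore odd
      when the parities agree.\<close>
    let ?c = "w1 @ butlast (rev w2)"
    obtain w' where w2: "w2 = r # w'" using w(2) by (cases w2) (auto simp: walk_def)
    have c: "?c = w1 @ rev w'" by (simp add: w2)
    have "path E (rev w2)"
      using w(2) by (simp add: walk_def insert_commute successively_rev)
    then have "path E (rev w')" "w' \<noteq> [] \<Longrightarrow> {hd w', r} \<in> E"
      by (simp_all add: w2 successively_append_iff last_rev)
    moreover have "w1 \<noteq> []" "path E w1" "hd w1 = r" "last w1 = a"
      using w(1) by (auto simp: walk_def)
    moreover have "last (r # w') = b" using w(2) by (simp add: walk_def w2)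
    ultimately have "closed_walk E ?c"
      using w(3) unfolding c closed_walk_def
      by (cases "w' = []") (simp_all add: successively_append_iff hd_rev last_rev)
    moreover have "odd (length ?c)"
      using eq w(2) by (simp add: walk_def)
    ultimately show False
      using odd_closed_walk_imp_odd_cycle[of E ?c] assms(1,3) by (auto simp: simple_graph_def)
  qed
  have "\<exists>a\<in>A. \<exists>b\<in>V - A. e = {a, b}" if eE: "e \<in> E" for e
  proof -
    have "card e = 2" using assms(1) eE by (simp add: simple_graph_def)
    then obtain a where "a \<in> e" by (metis all_not_in_conv card.empty zero_neq_numeral)
    then obtain b where e: "e = {a, b}" "a \<in> V" "b \<in> V"
      using simple_graph_edge[OF assms(1) eE] by blast
    obtain w1 w2 where w: "walk w1 a" "walk w2 b" using ex e by blast
    have "{a, b} \<in> E" "{b, a} \<in> E" using eE e by (auto simp: insert_commute)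
    show ?thesis
    proof (cases "odd (length w1)")
      case True
      then have "a \<in> A" using w e by (auto simp: A_def)
      moreover have "b \<notin> A" using parity[OF _ _ \<open>{b, a} \<in> E\<close>] True w(1) by (auto simp: A_def)
      ultimately show ?thesis using e by blast
    next
      case False
      then have "odd (length w2)" using parity[OF w \<open>{a, b} \<in> E\<close>] by simp
      then have "b \<in> A" using w e by (auto simp: A_def)
      moreover have "a \<notin> A" using parity[OF _ w(2) \<open>{a, b} \<in> E\<close>] \<open>odd (length w2)\<close> by (auto simp: A_def)
      ultimately show ?thesis using e by blast
    qed
  qed
  then show ?thesis
    unfolding bipartite_graph_def by (intro exI[of _ A] exI[of _ "V - A"]) (auto simp: A_def)
qed

section \<open>Critical degree multisets and ears\<close>

definition factorable :: "'v set set \<Rightarrow> 'v multiset \<Rightarrow> bool" where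
  "factorable E b \<longleftrightarrow> (\<exists>t. edge_sum E t b)"

lemma factorable_add: "factorable E a \<Longrightarrow> factorable E b \<Longrightarrow> factorable E (a + b)"
  unfolding factorable_def using edge_sum_add by blast

lemma factorable_path: "path E q \<Longrightarrow> even (length q) \<Longrightarrow> factorable E (mset q)"
  unfolding factorable_def using edge_sum_path by blast

text \<open>A version of factor-critical graphs with multiplicities. The clause on neighbours lets a
  vertex be added instead of removed.\<close>

definition critical :: "'v set set \<Rightarrow> 'v set \<Rightarrow> 'v multiset \<Rightarrow> bool" where
  "critical E S a \<longleftrightarrow> set_mset a = S \<and> (\<forall>v\<in>S. factorable E (a - {#v#})) \<and>
     (\<forall>v\<in>S. \<exists>w\<in>S. {v, w} \<in> E)"

lemma critical_subset:
  assumes "critical E S a" "\<And>e. e \<in> E \<Longrightarrow> e \<subseteq> V"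
  shows "S \<subseteq> V"
proof
  fix v assume "v \<in> S"
  then obtain w where "{v, w} \<in> E" using assms(1) by (auto simp: critical_def)
  then show "v \<in> V" using assms(2) by blast
qed

lemma critical_minus: "critical E S a \<Longrightarrow> v \<in> S \<Longrightarrow> \<exists>b. a = add_mset v b \<and> factorable E b"
  by (intro exI[of _ "a - {#v#}"]) (auto simp: critical_def)

text \<open>Remove a neighbour of \<open>v\<close> from \<open>a\<close>, then add the edge joining
  the two.\<close>

lemma critical_plus:
  assumes "critical E S a" "v \<in> S"
  shows "factorable E (add_mset v a)"
proof -
  obtain w where w: "w \<in> S" "{v, w} \<in> E" using assms by (auto simp: critical_def)
  then obtain b where b: "a = add_mset w b" "factorable E b" using critical_minus[OF assms(1)] by blast
  have "factorable E {#v, w#}"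
    using edge_sum_edge[OF w(2)] unfolding factorable_def by blast
  from factorable_add[OF b(2) this] show ?thesis by (simp add: b(1) add_mset_commute)
qed

text \<open>Removing a vertex from an odd cycle leaves a path on an even number of vertices, which
  every second edge covers.\<close>

lemma critical_cycle:
  assumes "graph_cycle E c" "odd (length c)"
  shows "critical E (set c) (mset c)"
proof -
  have c: "length c \<ge> 3" "path E c" "{last c, hd c} \<in> E"
    using assms(1) by (auto simp: graph_cycle_iff closed_walk_def)
  have "factorable E (mset c - {#v#}) \<and> (\<exists>w\<in>set c. {v, w} \<in> E)" if v: "v \<in> set c" for v
  proof -
    obtain xs ys where s: "c = xs @ v # ys" using v by (meson split_list)
    have xs: "path E xs" and ys: "path E (v # ys)"
      using c(2) unfolding s by (simp_all add: successively_append_iff)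
    from ys have "path E ys" by (cases ys) auto
    moreover have "{last ys, hd xs} \<in> E" if "xs \<noteq> []" "ys \<noteq> []"
      using c(3) that unfolding s by simp
    ultimately have p: "path E (ys @ xs)"
      using xs by (auto simp: successively_append_iff)
    have "even (length (ys @ xs))" using assms(2) s by simp
    from factorable_path[OF p this] have "factorable E (mset c - {#v#})"
      by (simp add: s add.commute)
    moreover have "\<exists>w\<in>set c. {v, w} \<in> E"
    proof (cases ys)
      case Nil
      then have "last c = v" "c \<noteq> []" using s by simp_all
      then show ?thesis using c(3) hd_in_set[of c] by blast
    next
      case (Cons y zs)
      then show ?thesis using c(2) by (intro bexI[of _ y]) (auto simp: s successively_append_iff)
    qed
    ultimately show ?thesis by blast
  qed
  then show ?thesis by (auto simp: critical_def)
qed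

text \<open>
  An ear with inner vertices \<open>q\<close> and endpoints \<open>u\<close> and \<open>w\<close>; it may be closed. If the number of
  inner vertices is odd, then the parity is corrected by repeating an endpoint.
\<close>

lemma critical_ear:
  assumes a: "critical E S a" and uw: "u \<in> S" "w \<in> S" and q: "path E q" "q \<noteq> []" "set q \<inter> S = {}"
    and e: "{u, hd q} \<in> E" "{last q, w} \<in> E"
  shows "critical E (S \<union> set q) (a + mset q + (if even (length q) then {#} else {#w#}))"
    (is "critical E _ ?a'")
proof -
  have "factorable E (?a' - {#v#})" if v: "v \<in> S" for v
  proof -
    obtain b where b: "a = add_mset v b" "factorable E b" using critical_minus[OF a v] by blast
    \<comment> \<open>For a vertex of the old set the ear is covered on its own; the repeated
      \<open>w\<close> makes its number of vertices even.\<close>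
    have "factorable E (mset q + (if even (length q) then {#} else {#w#}))"
      using factorable_path[of E q] factorable_path[of E "q @ [w]"] q e
      by (auto simp: successively_append_iff)
    from factorable_add[OF b(2) this] show ?thesis by (simp add: b(1) add.assoc)
  qed
  moreover have "factorable E (?a' - {#v#})" if v: "v \<in> set q" for v
  proof -
    obtain xs ys where s: "q = xs @ v # ys" using v by (meson split_list)
    have xs: "path E xs" and "path E (v # ys)"
      using q(1) unfolding s by (simp_all add: successively_append_iff)
    then have ys: "path E ys" by (cases ys) simp_all
    have uxs: "path E (u # xs)" using xs e(1) unfolding s by (cases xs) simp_all
    have ysw: "path E (ys @ [w])"
      using ys e(2) unfolding s by (cases "ys = []") (simp_all add: successively_append_iff)
    have a': "?a' - {#v#} = a + mset xs + mset ys + (if even (length q) then {#} else {#w#})"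
      by (simp add: s)
    \<comment> \<open>Removing \<open>v\<close> splits the ear into a piece next to \<open>u\<close>
      and one next to \<open>w\<close>. A piece of odd length borrows its endpoint, from
      \<open>a\<close> or from the repeated \<open>w\<close>; if both are even, the repeated
      \<open>w\<close> is absorbed by \<open>critical_plus\<close>.\<close>
    consider "even (length xs)" "even (length ys)" | "even (length xs)" "odd (length ys)"
      | "odd (length xs)" "even (length ys)" | "odd (length xs)" "odd (length ys)" by blast
    then show ?thesis
    proof cases
      case 1
      then have "factorable E (add_mset w a + mset xs + mset ys)"
        by (intro factorable_add critical_plus[OF a uw(2)] factorable_path xs uxs ys ysw)
      then show ?thesis unfolding a' using 1 by (simp add: s)
    next
      case 2
      obtain b where b: "a = add_mset w b" "factorable E b" using critical_minus[OF a uw(2)] by blast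
      have "factorable E (b + mset xs + mset (ys @ [w]))"
        using 2 by (intro factorable_add b factorable_path xs uxs ys ysw) auto
      then show ?thesis unfolding a' using 2 by (simp add: s b)
    next
      case 3
      obtain b where b: "a = add_mset u b" "factorable E b" using critical_minus[OF a uw(1)] by blast
      have "factorable E (b + mset (u # xs) + mset ys)"
        using 3 by (intro factorable_add b factorable_path xs uxs ys ysw) auto
      then show ?thesis unfolding a' using 3 by (simp add: s b)
    next
      case 4
      obtain b where b: "a = add_mset u b" "factorable E b" using critical_minus[OF a uw(1)] by blast
      have "factorable E (b + mset (u # xs) + mset (ys @ [w]))"
        using 4 by (intro factorable_add b factorable_path xs uxs ys ysw) auto
      then show ?thesis unfolding a' using 4 by (simp add: s b)
    qed
  qed
  moreover have "set_mset ?a' = S \<union> set q" using a uw by (auto simp: critical_def)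
  moreover have "\<exists>w\<in>S \<union> set q. {v, w} \<in> E" if v: "v \<in> set q" for v
  proof -
    obtain xs ys where s: "q = xs @ v # ys" using v by (meson split_list)
    show ?thesis
    proof (cases ys)
      case Nil
      then show ?thesis using e(2) uw by (intro bexI[of _ w]) (auto simp: s)
    next
      case (Cons y zs)
      then show ?thesis using q(1) by (intro bexI[of _ y]) (auto simp: s successively_append_iff)
    qed
  qed
  moreover have "\<exists>w\<in>S \<union> set q. {v, w} \<in> E" if "v \<in> S" for v
    using a that by (auto simp: critical_def)
  ultimately show ?thesis by (auto simp: critical_def)
qed

section \<open>Counting the edges of paths and cycles\<close>

fun path_edges :: "'v list \<Rightarrow> 'v set set" where
  "path_edges (x # y # q) = insert {x, y} (path_edges (y # q))"
| "path_edges _ = {}"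

lemma path_edges_props:
  "finite (path_edges q)" "e \<in> path_edges q \<Longrightarrow> e \<subseteq> set q \<and> e \<noteq> {}"
  "path E q \<Longrightarrow> path_edges q \<subseteq> E"
  by (induction q rule: path_edges.induct) auto

lemma card_path_edges: "distinct q \<Longrightarrow> card (path_edges q) = length q - 1"
proof (induction q rule: path_edges.induct)
  case (1 x y q)
  then have "{x, y} \<notin> path_edges (y # q)" using path_edges_props(2)[of "{x, y}" "y # q"] by auto
  with 1 show ?case by (simp add: path_edges_props)
qed auto

text \<open>A path has one edge fewer than vertices, and the closing edge is new since the cycle has
  at least three vertices.\<close>

lemma card_cycle_edges:
  assumes "finite E" "graph_cycle E c"
  shows "length c \<le> card (induced_edges E (set c))"
proof -
  have c: "length c \<ge> 3" "distinct c" "path E c" "{last c, hd c} \<in> E"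
    using assms(2) by (auto simp: graph_cycle_iff closed_walk_def)
  obtain x y z q' where "c = x # y # z # q'"
    using c(1) by (auto simp: Suc_le_length_iff numeral_3_eq_3)
  then obtain q where q: "c = x # y # q" "q \<noteq> []" by simp
  have "{last c, hd c} \<noteq> {x, y}" using c(2) q by (auto simp: doubleton_eq_iff)
  moreover have "{last c, hd c} \<notin> path_edges (y # q)"
    using path_edges_props(2)[of "{last c, hd c}" "y # q"] c(2) q by auto
  ultimately have "{last c, hd c} \<notin> path_edges c" by (simp add: q)
  then have "length c = card (insert {last c, hd c} (path_edges c))"
    using card_path_edges[OF c(2)] q by (simp add: path_edges_props)
  also have "\<dots> \<le> card (induced_edges E (set c))"
    using assms(1) path_edges_props(2)[of _ c] path_edges_props(3)[OF c(3)] c(4) q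
    by (intro card_mono) (auto simp: induced_edges_def)
  finally show ?thesis .
qed

text \<open>Walk towards \<open>u\<close> and stop before the first vertex of \<open>S\<close>; if
  the start recurs, restart from the recurrence. The vertices collected become the inner vertices of
  an ear.\<close>

lemma path_to_set:
  assumes "(p, u) \<in> (adj E)\<^sup>*" "u \<in> S" "p \<notin> S"
  shows "\<exists>q w. q \<noteq> [] \<and> hd q = p \<and> distinct q \<and> set q \<inter> S = {} \<and> path E q \<and> w \<in> S \<and> {last q, w} \<in> E"
  using assms(1,3)
proof (induction rule: converse_rtrancl_induct)
  case base
  then show ?case using assms(2) by simp
next
  case (step p p')
  show ?case
  proof (cases "p' \<in> S")
    case True
    then show ?thesis using step.prems step.hyps(1) by (intro exI[of _ "[p]"] exI[of _ p']) (auto simp: adj_def)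
  next
    case False
    from step.IH[OF this] obtain q w where q: "q \<noteq> []" "hd q = p'" "distinct q" "set q \<inter> S = {}" "path E q"
      "w \<in> S" "{last q, w} \<in> E" by blast
    show ?thesis
    proof (cases "p \<in> set q")
      case True
      then obtain xs ys where "q = xs @ p # ys" by (meson split_list)
      then show ?thesis using q
        by (intro exI[of _ "p # ys"] exI[of _ w]) (auto simp: successively_append_iff)
    next
      case False
      then show ?thesis using q step.prems step.hyps(1)
        by (intro exI[of _ "p # q"] exI[of _ w]) (auto simp: adj_def successively_Cons)
    qed
  qed
qed

section \<open>Components\<close>

lemma sym_adj: "sym (adj E)"
  by (auto simp: sym_def adj_def insert_commute)

abbreviation reach :: "'v set \<Rightarrow> 'v set set \<Rightarrow> 'v rel" where
  "reach V E \<equiv> {(u, v). u \<in> V \<and> v \<in> V \<and> (u, v) \<in> (adj E)\<^sup>*}"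

lemma equiv_reach: "equiv V (reach V E)"
proof (rule equivI)
  show "sym (reach V E)"
    using symD[OF sym_rtrancl[OF sym_adj]] by (fast intro: symI)
  show "trans (reach V E)"
    by (rule transI) (use rtrancl_trans in fast)
qed (auto simp: refl_on_def)

lemma components_connected_graph:
  assumes "connected_graph V E" shows "components_graph V E = {V}"
proof -
  have "reach V E `` {x} = V" if "x \<in> V" for x
    using assms that unfolding connected_graph_def by blast
  moreover have "V \<noteq> {}" using assms by (simp add: connected_graph_def)
  ultimately show ?thesis unfolding components_graph_def quotient_def by auto
qed

lemma component_props:
  assumes "simple_graph V E" "K \<in> components_graph V E"
  shows "K \<subseteq> V" "K \<noteq> {}" "e \<in> E \<Longrightarrow> e \<inter> K \<noteq> {} \<Longrightarrow> e \<subseteq> K"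
    "simple_graph K (induced_edges E K)" "connected_graph K (induced_edges E K)"
proof -
  obtain x where K: "K = reach V E `` {x}" "x \<in> V"
    using assms(2) unfolding components_graph_def by (rule quotientE)
  have memK: "y \<in> K \<longleftrightarrow> y \<in> V \<and> (x, y) \<in> (adj E)\<^sup>*" for y using K by simp
  show sub: "K \<subseteq> V" "K \<noteq> {}" using memK K(2) by blast+
  show cl: "e \<subseteq> K" if e: "e \<in> E" "e \<inter> K \<noteq> {}" for e
  proof -
    obtain a where a: "a \<in> e" "a \<in> K" using e(2) by blast
    then obtain b where ab: "e = {a, b}" "a \<in> V" "b \<in> V"
      using simple_graph_edge[OF assms(1) e(1)] by blast
    have "(x, a) \<in> (adj E)\<^sup>*" "(a, b) \<in> adj E" using memK a(2) ab(1) e(1) by (simp_all add: adj_def)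
    then have "(x, b) \<in> (adj E)\<^sup>*" by (rule rtrancl_into_rtrancl)
    then show ?thesis using a ab memK by simp
  qed
  have "finite K" using sub(1) assms(1) by (auto simp: simple_graph_def dest: finite_subset)
  then show "simple_graph K (induced_edges E K)"
    using assms(1) by (simp add: simple_graph_def induced_edges_def)
  have ind: "(u, v) \<in> (adj (induced_edges E K))\<^sup>* \<and> v \<in> K" if "(u, v) \<in> (adj E)\<^sup>*" "u \<in> K" for u v
    using that
  proof (induction rule: rtrancl_induct)
    case (step y z)
    have yz: "{y, z} \<in> E" "y \<in> K" using step.hyps(2) step.IH[OF step.prems] by (simp_all add: adj_def)
    with cl[of "{y, z}"] have "(y, z) \<in> adj (induced_edges E K)" "z \<in> K"
      by (simp_all add: adj_def induced_edges_def)
    then show ?case using step.IH[OF step.prems] by (blast intro: rtrancl_into_rtrancl)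
  qed simp
  have "(u, v) \<in> (adj E)\<^sup>*" if "u \<in> K" "v \<in> K" for u v
  proof -
    have "(u, x) \<in> (adj E)\<^sup>*" "(x, v) \<in> (adj E)\<^sup>*"
      using that memK symD[OF sym_rtrancl[OF sym_adj], of x u E] by simp_all
    then show ?thesis by (rule rtrancl_trans)
  qed
  with ind sub show "connected_graph K (induced_edges E K)"
    unfolding connected_graph_def by blast
qed

lemma components_disjoint:
  assumes "K \<in> components_graph V E" "L \<in> components_graph V E" "K \<noteq> L"
  shows "K \<inter> L = {}"
  using quotient_disj[OF equiv_reach[of V E], of K L] assms unfolding components_graph_def by blast

lemma Union_components: "\<Union> (components_graph V E) = V"
  using Union_quotient[OF equiv_reach[of V E]] unfolding components_graph_def .

lemma finite_components: "finite V \<Longrightarrow> finite (components_graph V E)"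
  unfolding components_graph_def by (rule finite_quotient) auto

text \<open>A connected graph has one component, and deleting a non-bridge does not increase this
  number.\<close>

lemma connected_if_not_bridge:
  assumes "finite V" "connected_graph V E" "e \<in> E" "\<not> is_bridge V E e" "u \<in> V" "v \<in> V"
  shows "(u, v) \<in> (adj (E - {e}))\<^sup>*"
proof -
  let ?R = "reach V (E - {e})"
  have "card (components_graph V (E - {e})) \<le> 1"
    using assms(3,4) components_connected_graph[OF assms(2)] by (simp add: is_bridge_def)
  moreover have "?R `` {u} \<in> components_graph V (E - {e})" "?R `` {v} \<in> components_graph V (E - {e})"
    unfolding components_graph_def by (rule quotientI, fact)+
  ultimately have "?R `` {u} = ?R `` {v}"
    using card_le_Suc0_iff_eq[OF finite_components[OF assms(1), of "E - {e}"]] by simp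
  moreover have "v \<in> ?R `` {v}" using assms(6) by simp
  ultimately have "v \<in> ?R `` {u}" by simp
  then show ?thesis by simp
qed

section \<open>Ear decompositions\<close>

text \<open>Bridges count twice: a bridge \<open>{u, p}\<close> with \<open>u \<in> S\<close> becomes the closed ear \<open>u, p, u\<close>.\<close>

definition bridge_weight :: "'v set \<Rightarrow> 'v set set \<Rightarrow> 'v set set \<Rightarrow> nat" where
  "bridge_weight V E F = card F + card {e\<in>F. is_bridge V E e}"

text \<open>Bridges are always those of the whole graph, so counts over disjoint edge sets add; each
  ear can be charged to its own new edges.\<close>

lemma bridge_weight_mono_add:
  assumes "finite G" "F \<union> N \<subseteq> G" "F \<inter> N = {}"
  shows "bridge_weight V E F + bridge_weight V E N \<le> bridge_weight V E G"
proof -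
  have f: "finite F" "finite N" using assms finite_subset by auto
  have "card F + card N = card (F \<union> N)" using f assms(3) by (simp add: card_Un_disjoint)
  also have "\<dots> \<le> card G" using assms by (intro card_mono)
  finally have 1: "card F + card N \<le> card G" .
  have "card {e\<in>F. is_bridge V E e} + card {e\<in>N. is_bridge V E e} =
      card ({e\<in>F. is_bridge V E e} \<union> {e\<in>N. is_bridge V E e})"
    using f assms(3) by (subst card_Un_disjoint) auto
  also have "\<dots> \<le> card {e\<in>G. is_bridge V E e}" using assms by (intro card_mono) auto
  finally show ?thesis using 1 by (simp add: bridge_weight_def)
qed

text \<open>Some edge leaves \<open>S\<close>. If it is a bridge, the closed ear over it costs two
  vertices and gains weight two. Otherwise its outer end reaches \<open>S\<close> without it, giving
  an ear with \<open>n\<close> inner vertices and \<open>n + 1\<close> new edges, which costs at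
  most \<open>n + 1\<close> vertices.\<close>

lemma critical_extend:
  assumes G: "simple_graph V E" "connected_graph V E"
    and S: "S \<subseteq> V" "S \<noteq> {}" "S \<noteq> V" and a: "critical E S a"
    and size: "size a \<le> bridge_weight V E (induced_edges E S)"
  shows "\<exists>S' a'. S \<subset> S' \<and> S' \<subseteq> V \<and> critical E S' a' \<and>
    size a' \<le> bridge_weight V E (induced_edges E S')"
proof -
  have finE: "finite E" and EV: "\<And>e. e \<in> E \<Longrightarrow> e \<subseteq> V" and finV: "finite V"
    using G(1) by (auto simp: simple_graph_def intro: finite_subset[of E "Pow V"])
  obtain u0 p0 where "u0 \<in> S" "p0 \<in> V" "p0 \<notin> S" using S by blast
  then have "(u0, p0) \<in> (adj E)\<^sup>*" using G(2) S(1) by (auto simp: connected_graph_def)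
  then have "\<exists>u p. u \<in> S \<and> p \<notin> S \<and> {u, p} \<in> E" using \<open>u0 \<in> S\<close> \<open>p0 \<notin> S\<close>
    by (induction rule: rtrancl_induct) (auto simp: adj_def)
  then obtain u p where up: "u \<in> S" "p \<notin> S" "{u, p} \<in> E" by blast
  then have V: "u \<in> V" "p \<in> V" using EV by auto
  show ?thesis
  proof (cases "is_bridge V E {u, p}")
    case True
    have "critical E (S \<union> set [p]) (a + mset [p] + (if even (length [p]) then {#} else {#u#}))"
      by (rule critical_ear[OF a]) (use up in \<open>auto simp: insert_commute\<close>)
    then have c: "critical E (insert p S) (a + {#p, u#})" by (simp add: add_mset_commute)
    have "bridge_weight V E (induced_edges E S) + bridge_weight V E {{u, p}}
        \<le> bridge_weight V E (induced_edges E (insert p S))"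
      by (rule bridge_weight_mono_add) (use up finE in \<open>auto simp: induced_edges_def\<close>)
    moreover have "bridge_weight V E {{u, p}} = 2"
    proof -
      have "{e \<in> {{u, p}}. is_bridge V E e} = {{u, p}}" using True by auto
      then show ?thesis by (simp add: bridge_weight_def)
    qed
    ultimately show ?thesis using c size up V S(1)
      by (intro exI[of _ "insert p S"] exI[of _ "a + {#p, u#}"]) auto
  next
    case False
    from path_to_set[OF connected_if_not_bridge[OF finV G(2) up(3) False V(2,1)] up(1,2)]
    obtain q w where q: "q \<noteq> []" "hd q = p" "distinct q" "set q \<inter> S = {}" "path (E - {{u, p}}) q"
      "w \<in> S" "{last q, w} \<in> E - {{u, p}}" by blast
    have pE: "path E q" using q(5) by (rule successively_mono) auto
    let ?a = "a + mset q + (if even (length q) then {#} else {#w#})"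
    have c: "critical E (S \<union> set q) ?a"
      by (rule critical_ear[OF a up(1) q(6) pE q(1) q(4)]) (use q up in auto)
    \<comment> \<open>The edges of the ear. The first and the last one differ because the way back
      to \<open>S\<close> avoids \<open>{u, p}\<close>.\<close>
    let ?N = "insert {u, p} (insert {last q, w} (path_edges q))"
    have pq: "p \<in> set q" "last q \<in> set q" using q by auto
    have "{u, p} \<notin> path_edges q" "{last q, w} \<notin> path_edges q"
      using path_edges_props(2)[of _ q] up q(4,6) by blast+
    moreover have "{u, p} \<noteq> {last q, w}" using q(7) by blast
    ultimately have "card ?N = Suc (Suc (card (path_edges q)))"
      using path_edges_props(1)[of q] card_insert_disjoint insert_iff finite_insert by metis
    then have cardN: "card ?N = length q + 1"
      using card_path_edges[OF q(3)] q(1) by (cases q) simp_all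
    have "path_edges q \<subseteq> E" using path_edges_props(3)[OF pE] .
    then have "induced_edges E S \<union> ?N \<subseteq> induced_edges E (S \<union> set q)"
      using path_edges_props(2)[of _ q] up q(6,7) pq by (auto simp: induced_edges_def)
    moreover have "induced_edges E S \<inter> ?N = {}"
      using path_edges_props(2)[of _ q] q(4) pq by (fastforce simp: induced_edges_def)
    ultimately have "bridge_weight V E (induced_edges E S) + bridge_weight V E ?N
        \<le> bridge_weight V E (induced_edges E (S \<union> set q))"
      using finE by (intro bridge_weight_mono_add) (auto simp: induced_edges_def)
    moreover have "length q + 1 \<le> bridge_weight V E ?N"
      unfolding bridge_weight_def cardN by simp
    moreover have "size ?a \<le> size a + length q + 1" by simp
    moreover have "S \<union> set q \<subseteq> V" by (rule critical_subset[OF c EV])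
    ultimately show ?thesis using c size pq up
      by (intro exI[of _ "S \<union> set q"] exI[of _ ?a]) auto
  qed
qed

text \<open>An odd cycle has at least as many induced edges as vertices and starts the construction.
  A maximal \<open>S\<close> within the size bound must be all of \<open>V\<close>, since otherwise
  \<open>critical_extend\<close> enlarges it.\<close>

lemma critical_exists:
  assumes G: "simple_graph V E" "connected_graph V E" and "has_odd_cycle E"
  shows "\<exists>a. critical E V a \<and> size a \<le> card E + card {e. is_bridge V E e}"
proof -
  have finE: "finite E" and EV: "\<And>e. e \<in> E \<Longrightarrow> e \<subseteq> V" and finV: "finite V"
    using G(1) by (auto simp: simple_graph_def intro: finite_subset[of E "Pow V"])
  define good where "good S \<longleftrightarrow> S \<subseteq> V \<and> S \<noteq> {} \<and>
    (\<exists>a. critical E S a \<and> size a \<le> bridge_weight V E (induced_edges E S))" for S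
  obtain c where c: "graph_cycle E c" "odd (length c)" using assms(3) by (auto simp: has_odd_cycle_def)
  have crit: "critical E (set c) (mset c)" by (rule critical_cycle[OF c])
  have "good (set c)"
  proof -
    have "set c \<subseteq> V" by (rule critical_subset[OF crit EV])
    moreover have "set c \<noteq> {}" using c by auto
    moreover have "size (mset c) \<le> bridge_weight V E (induced_edges E (set c))"
      using card_cycle_edges[OF finE c(1)] by (simp add: bridge_weight_def)
    ultimately show ?thesis using crit unfolding good_def by blast
  qed
  moreover have "finite {S. good S}"
    by (rule finite_subset[of _ "Pow V"]) (use finV in \<open>auto simp: good_def\<close>)
  ultimately obtain S where S: "good S" "\<And>S'. good S' \<Longrightarrow> S \<subseteq> S' \<Longrightarrow> S = S'"
    using finite_has_maximal[of "{S. good S}"] by auto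
  then obtain a where a: "S \<subseteq> V" "S \<noteq> {}" "critical E S a"
    "size a \<le> bridge_weight V E (induced_edges E S)" unfolding good_def by blast
  have "S = V"
  proof (rule ccontr)
    assume "S \<noteq> V"
    from critical_extend[OF G a(1,2) this a(3,4)] obtain S' where "S \<subset> S'" "good S'"
      using a(2) unfolding good_def by blast
    then show False using S(2) by blast
  qed
  moreover have "induced_edges E V = E" using EV by (auto simp: induced_edges_def)
  moreover have "{e\<in>E. is_bridge V E e} = {e. is_bridge V E e}" by (auto simp: is_bridge_def)
  ultimately show ?thesis using a(3,4) by (auto simp: bridge_weight_def)
qed

section \<open>Powers of edge ideals\<close>

definition exponents :: "('v::finite \<Rightarrow>\<^sub>0 nat) \<Rightarrow> 'v multiset" where
  "exponents k = (\<Sum>v\<in>UNIV. replicate_mset (lookup k v) v)"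

lemma count_exponents [simp]: "count (exponents k) v = lookup k v"
  by (simp add: exponents_def count_sum)

lemma exponents_add: "exponents (k + l) = exponents k + exponents l"
  by (rule multiset_eqI) (simp add: lookup_add)

lemma exponents_inj: "exponents k = exponents l \<longleftrightarrow> k = l"
  by (auto simp: multiset_eq_iff intro: poly_mapping_eqI)

lemma exponents_surj: "\<exists>k. exponents k = h"
proof
  show "exponents (Abs_poly_mapping (count h)) = h"
    by (rule multiset_eqI) simp
qed

lemma set_exponents: "set_mset (exponents k) = keys k"
  by (auto simp: in_keys_iff simp flip: count_greater_zero_iff)

lemma exponents_single: "exponents (Poly_Mapping.single v (Suc 0)) = {#v#}"
  by (rule multiset_eqI) (simp add: lookup_single when_def)

definition edge_monomials :: "'v::finite set set \<Rightarrow> nat \<Rightarrow> ('v \<Rightarrow>\<^sub>0 nat) set" where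
  "edge_monomials E t = {k. has_edges E t (exponents k)}"

lemma add_closed_edge_monomials: "add_closed (edge_monomials E t)"
  unfolding add_closed_def edge_monomials_def
  by (auto simp: exponents_add elim: has_edges_mono)

lemma has_edges_0: "has_edges E 0 h"
  unfolding has_edges_def using edge_sum_0 by (intro exI[of _ "{#}"]) simp

lemma edge_monomials_Suc:
  "{a + b | a b. a \<in> edge_monomials E t \<and> b \<in> edge_monomials E 1} = edge_monomials E (Suc t)"
proof safe
  fix a b assume "a \<in> edge_monomials E t" "b \<in> edge_monomials E 1"
  then show "a + b \<in> edge_monomials E (Suc t)"
    using has_edges_add[of E t "exponents a" 1] by (simp add: edge_monomials_def exponents_add)
next
  fix k assume "k \<in> edge_monomials E (Suc t)"
  then obtain x y h where h: "{x, y} \<in> E" "has_edges E t h" "exponents k = h + {#x, y#}"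
    unfolding edge_monomials_def has_edges_Suc by blast
  obtain a b where ab: "exponents a = h" "exponents b = {#x, y#}" using exponents_surj by metis
  have "has_edges E 1 {#x, y#}" using edge_sum_edge[OF h(1)] unfolding has_edges_def by blast
  moreover have "k = a + b" using ab h(3) by (simp flip: exponents_inj add: exponents_add)
  ultimately show "\<exists>a b. k = a + b \<and> a \<in> edge_monomials E t \<and> b \<in> edge_monomials E 1"
    using ab h unfolding edge_monomials_def
    by (intro exI[of _ a] exI[of _ b] conjI CollectI) simp_all
qed

lemma edge_ideal_eq:
  "(edge_ideal E :: ('v::finite, 'k::field) mpoly set) = monomial_ideal (edge_monomials E 1)"
proof
  interpret R: cring "ty :: ('v, 'k) mpoly ring" by (rule cring_from_type_algebra)
  let ?G = "{var u * var v | u v. {u, v} \<in> E} :: ('v, 'k) mpoly set"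
  have id: "ideal (edge_ideal E :: ('v, 'k) mpoly set) ty"
    unfolding edge_ideal_def by (rule R.genideal_ideal) simp
  have sub: "?G \<subseteq> edge_ideal E"
    unfolding edge_ideal_def by (rule R.genideal_self) simp
  have vv: "var u * var v = Poly_Mapping.single (Poly_Mapping.single u 1 + Poly_Mapping.single v 1) (1::'k)"
    for u v :: 'v by (simp add: var_def mult_single)
  have "var u * var v \<in> (monomial_ideal (edge_monomials E 1) :: ('v, 'k) mpoly set)"
    if "{u, v} \<in> E" for u v
  proof -
    have "has_edges E 1 {#u, v#}" using edge_sum_edge[OF that] unfolding has_edges_def by blast
    then show ?thesis
      unfolding vv monomial_ideal_def edge_monomials_def
      by (simp add: exponents_add exponents_single add_mset_commute)
  qed
  then have "?G \<subseteq> monomial_ideal (edge_monomials E 1)" by blast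
  then show "edge_ideal E \<subseteq> (monomial_ideal (edge_monomials E 1) :: ('v, 'k) mpoly set)"
    unfolding edge_ideal_def
    by (rule R.genideal_minimal[OF ideal_monomial_ideal[OF add_closed_edge_monomials]])
  show "monomial_ideal (edge_monomials E 1) \<subseteq> (edge_ideal E :: ('v, 'k) mpoly set)"
  proof (rule monomial_ideal_subset_ideal[OF id])
    fix k assume "k \<in> edge_monomials E 1"
    then obtain x y h where h: "{x, y} \<in> E" "exponents k = h + {#x, y#}"
      unfolding edge_monomials_def One_nat_def has_edges_Suc by blast
    obtain l where l: "exponents l = h" using exponents_surj by metis
    have "exponents k = exponents (l + (Poly_Mapping.single x 1 + Poly_Mapping.single y 1))"
      using h(2) l by (simp add: exponents_add exponents_single add_mset_commute)
    then have "k = l + (Poly_Mapping.single x 1 + Poly_Mapping.single y 1)"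
      by (simp only: exponents_inj)
    then have "Poly_Mapping.single k 1 = Poly_Mapping.single l 1 * (var x * var y :: ('v, 'k) mpoly)"
      unfolding vv by (simp add: mult_single)
    moreover have "(var x * var y :: ('v, 'k) mpoly) \<in> edge_ideal E" using sub h(1) by blast
    ultimately show "Poly_Mapping.single k 1 \<in> (edge_ideal E :: ('v, 'k) mpoly set)"
      using ideal_tyD(3)[OF id] by simp
  qed
qed

text \<open>Splitting off one edge mirrors multiplication by the ideal; the zeroth power is the
  whole ring.\<close>

lemma edge_ideal_power:
  "(edge_ideal E :: ('v::finite, 'k::field) mpoly set) [^]\<^bsub>ideals_set ty\<^esub> (t::nat)
    = monomial_ideal (edge_monomials E t)"
proof (induction t)
  interpret R: cring "ty :: ('v, 'k) mpoly ring" by (rule cring_from_type_algebra)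
  interpret I: comm_monoid "ideals_set (ty :: ('v, 'k) mpoly ring)"
    by (rule R.ideals_set_is_comm_monoid)
  case 0
  have "edge_monomials E 0 = UNIV" by (auto simp: edge_monomials_def has_edges_0)
  then show ?case by (simp add: ideals_set_def monomial_ideal_def)
next
  case (Suc t)
  interpret R: cring "ty :: ('v, 'k) mpoly ring" by (rule cring_from_type_algebra)
  interpret I: comm_monoid "ideals_set (ty :: ('v, 'k) mpoly ring)"
    by (rule R.ideals_set_is_comm_monoid)
  have "(edge_ideal E :: ('v, 'k) mpoly set) [^]\<^bsub>ideals_set ty\<^esub> Suc t
      = ideal_prod ty (monomial_ideal (edge_monomials E t)) (edge_ideal E)"
    using Suc by (simp add: ideals_set_def)
  also have "\<dots> = monomial_ideal (edge_monomials E (Suc t))"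
    unfolding edge_ideal_eq
      ideal_prod_monomial_ideal[OF add_closed_edge_monomials add_closed_edge_monomials]
      edge_monomials_Suc ..
  finally show ?case .
qed

text \<open>The quotient of the \<open>t\<close>-th power of the edge ideal by the monomial \<open>h\<close> is the prime
  ideal generated by \<open>U\<close>.\<close>

definition colon_witness :: "'v set set \<Rightarrow> nat \<Rightarrow> 'v set \<Rightarrow> 'v multiset \<Rightarrow> bool" where
  "colon_witness E t U h \<longleftrightarrow> (\<forall>c. has_edges E t (c + h) \<longleftrightarrow> set_mset c \<inter> U \<noteq> {})"

lemma Ass_powD:
  assumes "P \<in> Ass_pow (edge_ideal E :: ('v::finite, 'k::field) mpoly set) t"
  shows "primeideal P ty" "\<exists>U h. P = monomial_ideal (meets U) \<and> colon_witness E t U h"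
proof -
  show "primeideal P ty" using assms by (simp add: Ass_pow_def Ass_def)
  have "P \<in> Ass ty (monomial_ideal (edge_monomials E t))"
    using assms unfolding Ass_pow_def edge_ideal_power .
  from Ass_monomial_idealD[OF add_closed_edge_monomials this] obtain U h where
    Uh: "P = monomial_ideal (meets U)" "\<And>k. k + h \<in> edge_monomials E t \<longleftrightarrow> k \<in> meets U" by blast
  have "colon_witness E t U (exponents h)"
    unfolding colon_witness_def
  proof
    fix c :: "'v multiset"
    obtain k where "c = exponents k" using exponents_surj by metis
    then show "has_edges E t (c + exponents h) \<longleftrightarrow> set_mset c \<inter> U \<noteq> {}"
      using Uh(2)[of k] unfolding edge_monomials_def meets_def mem_Collect_eq
      by (simp add: exponents_add set_exponents)
  qed
  with Uh(1) show "\<exists>U h. P = monomial_ideal (meets U) \<and> colon_witness E t U h" by blast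
qed

text \<open>Primality is a premise: it comes from \<open>primeideal_max_ideal\<close> or from the
  same prime being associated to another power.\<close>

lemma Ass_powI:
  assumes "primeideal (monomial_ideal (meets U) :: ('v::finite, 'k::field) mpoly set) ty"
    and "colon_witness E t U h"
  shows "(monomial_ideal (meets U) :: ('v, 'k) mpoly set) \<in> Ass_pow (edge_ideal E) t"
proof -
  obtain l where l: "exponents l = h" using exponents_surj by metis
  have "k + l \<in> edge_monomials E t \<longleftrightarrow> k \<in> meets U" for k
    using assms(2) l unfolding edge_monomials_def meets_def colon_witness_def mem_Collect_eq
    by (simp add: exponents_add set_exponents)
  then show ?thesis
    unfolding Ass_pow_def edge_ideal_power
    by (intro Ass_monomial_idealI[OF add_closed_edge_monomials assms(1)])
qed

section \<open>Witnesses on disconnected graphs\<close>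

text \<open>Each edge has both ends or neither in \<open>K\<close>.\<close>

lemma even_size_filter_edge_sum:
  assumes "edge_sum F t b" and "\<And>e. e \<in> F \<Longrightarrow> e \<inter> K \<noteq> {} \<Longrightarrow> e \<subseteq> K"
  shows "even (size (filter_mset (\<lambda>v. v \<in> K) b))"
proof -
  obtain N where N: "\<forall>(x, y)\<in>#N. {x, y} \<in> F" "b = image_mset fst N + image_mset snd N"
    using assms(1) by (auto simp: edge_sum_def)
  have "\<forall>(x, y)\<in>#N. x \<in> K \<longleftrightarrow> y \<in> K" using N(1) assms(2) by fastforce
  then show ?thesis unfolding N(2)
    by (induction N) auto
qed

lemma size_partition_mset:
  assumes "finite \<K>" "\<And>K L. K \<in> \<K> \<Longrightarrow> L \<in> \<K> \<Longrightarrow> K \<noteq> L \<Longrightarrow> K \<inter> L = {}"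
    and "set_mset b \<subseteq> \<Union>\<K>"
  shows "size b = (\<Sum>K\<in>\<K>. size (filter_mset (\<lambda>v. v \<in> K) b))"
  using assms(3)
proof (induction b)
  case (add x b)
  then obtain K where K: "K \<in> \<K>" "x \<in> K" by auto
  have "(\<Sum>L\<in>\<K>. size (filter_mset (\<lambda>v. v \<in> L) (add_mset x b)))
      = (\<Sum>L\<in>\<K>. size (filter_mset (\<lambda>v. v \<in> L) b) + (if L = K then 1 else 0))"
    using K assms(2) by (intro sum.cong refl) auto
  also have "\<dots> = size b + 1" using add K(1) assms(1) by (simp add: sum.distrib)
  finally show ?case by simp
qed simp

lemma components_witness:
  assumes G: "simple_graph C F" "C \<noteq> {}"
    and odd: "\<And>K. K \<in> components_graph C F \<Longrightarrow> has_odd_cycle (induced_edges F K)"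
  shows "\<exists>a r. set_mset a \<subseteq> C \<and> has_edges F r a \<and> (\<forall>v\<in>C. has_edges F (Suc r) (add_mset v a))
    \<and> \<not> has_edges F (Suc r) a \<and> 2 * r + 1 \<le> card F + num_bridges C F
    \<and> (connected_graph C F \<longrightarrow> size a = 2 * r + 1)"
proof -
  let ?\<K> = "components_graph C F"
  note props = component_props[OF G(1)]
  have finC: "finite C" and FC: "\<And>e. e \<in> F \<Longrightarrow> e \<subseteq> C" and finF: "finite F" and F2: "\<And>e. e \<in> F \<Longrightarrow> card e = 2"
    using G(1) by (auto simp: simple_graph_def intro: finite_subset[of F "Pow C"])
  have fin: "finite ?\<K>" by (rule finite_components[OF finC])
  have disj: "K \<inter> L = {}" if "K \<in> ?\<K>" "L \<in> ?\<K>" "K \<noteq> L" for K L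
    using components_disjoint that by metis
  let ?ind = "induced_edges F"
  have "\<exists>a. critical (?ind K) K a \<and> size a \<le> card (?ind K) + card {e. is_bridge K (?ind K) e}"
    if "K \<in> ?\<K>" for K
    by (rule critical_exists[OF props(4)[OF that] props(5)[OF that] odd[OF that]])
  then have "\<forall>K\<in>?\<K>. \<exists>a. critical (?ind K) K a \<and> size a \<le> card (?ind K) + card {e. is_bridge K (?ind K) e}"
    by blast
  from bchoice[OF this] obtain A where A: "\<And>K. K \<in> ?\<K> \<Longrightarrow> critical (?ind K) K (A K)"
    "\<And>K. K \<in> ?\<K> \<Longrightarrow> size (A K) \<le> card (?ind K) + card {e. is_bridge K (?ind K) e}" by blast
  define r where "r K = size (A K) div 2" for K
  have indF: "?ind K \<subseteq> F" for K by (auto simp: induced_edges_def)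
  have AK: "size (A K) = 2 * r K + 1 \<and> has_edges F (r K) (A K)" if K: "K \<in> ?\<K>" for K
  proof -
    obtain v where "v \<in> K" using props(2)[OF K] by blast
    then obtain b t where b: "A K = add_mset v b" "edge_sum (?ind K) t b"
      using critical_minus[OF A(1)[OF K]] unfolding factorable_def by blast
    then have "t = r K" "size (A K) = 2 * r K + 1"
      using edge_sum_size[OF b(2)] by (simp_all add: r_def)
    moreover have "has_edges F t (A K)"
      unfolding has_edges_def using edge_sum_mono[OF b(2) indF] b(1) by auto
    ultimately show ?thesis by simp
  qed
  have AKv: "has_edges F (Suc (r K)) (add_mset v (A K))" if K: "K \<in> ?\<K>" "v \<in> K" for K v
  proof -
    obtain t where t: "edge_sum (?ind K) t (add_mset v (A K))"
      using critical_plus[OF A(1)[OF K(1)] K(2)] unfolding factorable_def by blast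
    then have "t = Suc (r K)" using edge_sum_size[OF t] AK[OF K(1)] by simp
    then show ?thesis
      unfolding has_edges_def using edge_sum_mono[OF t indF] by auto
  qed
  define a where "a = (\<Sum>K\<in>?\<K>. A K)"
  define R where "R = (\<Sum>K\<in>?\<K>. r K)"
  have partial: "has_edges F (\<Sum>K\<in>\<L>. r K) (\<Sum>K\<in>\<L>. A K)" if "\<L> \<subseteq> ?\<K>" for \<L>
  proof -
    have "finite \<L>" using that fin by (rule finite_subset)
    then show ?thesis using that
      by (induction \<L>) (auto simp: has_edges_0 AK intro!: has_edges_add)
  qed
  have setA: "set_mset (A K) = K" if "K \<in> ?\<K>" for K
    using A(1)[OF that] by (simp add: critical_def)
  have seta: "set_mset a \<subseteq> C"
  proof
    fix v assume "v \<in># a"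
    then obtain K where K: "K \<in> ?\<K>" "v \<in># A K"
      unfolding a_def set_mset_sum[OF fin] by blast
    then have "v \<in> K" using setA by simp
    then show "v \<in> C" using props(1)[OF K(1)] by blast
  qed
  have 1: "has_edges F (Suc R) (add_mset v a)" if v: "v \<in> C" for v
  proof -
    obtain K where K: "K \<in> ?\<K>" "v \<in> K" using v Union_components[of C F] by blast
    have "a = A K + (\<Sum>L\<in>?\<K> - {K}. A L)" "R = r K + (\<Sum>L\<in>?\<K> - {K}. r L)"
      unfolding a_def R_def by (rule sum.remove[OF fin K(1)])+
    moreover have "has_edges F (Suc (r K) + (\<Sum>L\<in>?\<K> - {K}. r L)) (add_mset v (A K) + (\<Sum>L\<in>?\<K> - {K}. A L))"
      by (rule has_edges_add[OF AKv[OF K] partial]) blast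
    ultimately show ?thesis by simp
  qed
  have 2: "\<not> has_edges F (Suc R) a"
  proof
    assume "has_edges F (Suc R) a"
    then obtain b where b: "edge_sum F (Suc R) b" "b \<subseteq># a" unfolding has_edges_def by blast
    \<comment> \<open>Restricted to \<open>K\<close>, the edges cover an even number of at most
      \<open>2 * r K + 1\<close> occurrences.\<close>
    have le: "size (filter_mset (\<lambda>v. v \<in> K) b) \<le> 2 * r K" if K: "K \<in> ?\<K>" for K
    proof -
      have "filter_mset (\<lambda>v. v \<in> K) a = A K"
      proof (rule multiset_eqI)
        fix v
        have z: "count (A L) v = 0" if "v \<in> K" "L \<in> ?\<K> - {K}" for L
        proof -
          have "v \<notin> L" using disj[of L K] that K by blast
          then show ?thesis using setA[of L] that(2) by (simp add: count_eq_zero_iff)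
        qed
        have "count a v = count (A K) v + (\<Sum>L\<in>?\<K> - {K}. count (A L) v)"
          unfolding a_def count_sum using fin K by (rule sum.remove)
        moreover have "v \<notin> K \<Longrightarrow> count (A K) v = 0" using setA[OF K] by (simp add: count_eq_zero_iff)
        ultimately show "count (filter_mset (\<lambda>v. v \<in> K) a) v = count (A K) v"
          using z by (cases "v \<in> K") simp_all
      qed
      then have "filter_mset (\<lambda>v. v \<in> K) b \<subseteq># A K"
        using multiset_filter_mono[OF b(2), of "\<lambda>v. v \<in> K"] by simp
      from size_mset_mono[OF this] have "size (filter_mset (\<lambda>v. v \<in> K) b) \<le> 2 * r K + 1"
        using AK[OF K] by simp
      moreover have "even (size (filter_mset (\<lambda>v. v \<in> K) b))"
        by (rule even_size_filter_edge_sum[OF b(1)]) (rule props(3)[OF K])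
      ultimately show ?thesis by presburger
    qed
    have "set_mset b \<subseteq> C" using set_mset_mono[OF b(2)] seta by (rule subset_trans)
    then have sb: "set_mset b \<subseteq> \<Union>?\<K>" by (simp only: Union_components)
    have "size b = (\<Sum>K\<in>?\<K>. size (filter_mset (\<lambda>v. v \<in> K) b))"
      by (rule size_partition_mset[OF fin _ sb]) (rule disj)
    also have "\<dots> \<le> (\<Sum>K\<in>?\<K>. 2 * r K)" by (rule sum_mono[OF le])
    also have "\<dots> = 2 * R" by (simp add: R_def sum_distrib_left)
    finally show False using edge_sum_size[OF b(1)] by simp
  qed
  have 3: "2 * R + 1 \<le> card F + num_bridges C F"
  proof -
    have "?\<K> \<noteq> {}" using Union_components[of C F] G(2) by auto
    then have "1 \<le> card ?\<K>" using fin by (simp add: Suc_le_eq card_gt_0_iff)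
    \<comment> \<open>Every component brings its own surplus one; the single one on the left is
      covered because there is at least one component.\<close>
    then have "2 * R + 1 \<le> (\<Sum>K\<in>?\<K>. 2 * r K + 1)"
      unfolding sum.distrib R_def sum_distrib_left by simp
    also have "\<dots> = (\<Sum>K\<in>?\<K>. size (A K))" using AK by simp
    also have "\<dots> \<le> (\<Sum>K\<in>?\<K>. card (?ind K) + card {e. is_bridge K (?ind K) e})"
      by (rule sum_mono[OF A(2)])
    also have "\<dots> = (\<Sum>K\<in>?\<K>. card (?ind K)) + num_bridges C F"
      by (simp add: sum.distrib num_bridges_def)
    also have "(\<Sum>K\<in>?\<K>. card (?ind K)) = card (\<Union>K\<in>?\<K>. ?ind K)"
    proof (rule card_UN_disjoint[symmetric, OF fin])
      show "\<forall>K\<in>?\<K>. finite (?ind K)" using finF indF finite_subset by blast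
      show "\<forall>K\<in>?\<K>. \<forall>L\<in>?\<K>. K \<noteq> L \<longrightarrow> ?ind K \<inter> ?ind L = {}"
      proof (intro ballI impI, rule ccontr)
        fix K L assume KL: "K \<in> ?\<K>" "L \<in> ?\<K>" "K \<noteq> L" "?ind K \<inter> ?ind L \<noteq> {}"
        then obtain e where e: "e \<in> F" "e \<subseteq> K \<inter> L" by (auto simp: induced_edges_def)
        then have "e = {}" using disj[OF KL(1-3)] by simp
        then show False using F2[OF e(1)] by simp
      qed
    qed
    also have "\<dots> \<le> card F" using indF finF by (intro card_mono) auto
    finally show ?thesis by simp
  qed
  have 4: "size a = 2 * R + 1" if "connected_graph C F"
  proof -
    have K: "?\<K> = {C}" by (rule components_connected_graph[OF that])
    then show ?thesis using AK[of C] by (simp add: a_def R_def)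
  qed
  have "has_edges F R a" using partial[of ?\<K>] by (simp add: a_def R_def)
  with seta 1 2 3 4 show ?thesis
    by (intro exI[of _ a] exI[of _ R] conjI ballI impI)
qed

section \<open>Witnesses for monomial primes\<close>

lemma induced_simple_graph: "simple_graph V E \<Longrightarrow> C \<subseteq> V \<Longrightarrow> simple_graph C (induced_edges E C)"
  by (auto simp: simple_graph_def induced_edges_def intro: finite_subset)

text \<open>Every edge that meets the neighbourhood uses up at least one of its occurrences in
  \<open>g\<close>; the remaining edges lie in the core. If the subtraction truncates, zero edges
  are claimed.\<close>

lemma edges_outside_nbhd:
  assumes ind: "independent_set E (- U)" and h: "has_edges E t g"
  shows "has_edges (induced_edges E (core UNIV E U))
    (t - size (filter_mset (\<lambda>v. v \<in> nbhd E (- U)) g)) (filter_mset (\<lambda>v. v \<in> core UNIV E U) g)"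
proof -
  let ?B = "nbhd E (- U)" and ?C = "core UNIV E U"
  let ?d = "\<lambda>N. image_mset fst N + image_mset snd N"
  obtain N where N: "size N = t" "\<forall>(x, y)\<in>#N. {x, y} \<in> E" "?d N \<subseteq># g"
    using h unfolding has_edges_def edge_sum_def by blast
  define T where "T = (\<lambda>(x, y). x \<in> ?B \<or> y \<in> ?B)"
  have "size (filter_mset T N) \<le> size (filter_mset (\<lambda>v. v \<in> ?B) (?d N))"
    by (induction N) (auto simp: T_def)
  also have "\<dots> \<le> size (filter_mset (\<lambda>v. v \<in> ?B) g)"
    by (rule size_mset_mono[OF multiset_filter_mono[OF N(3)]])
  finally have T: "size (filter_mset T N) \<le> size (filter_mset (\<lambda>v. v \<in> ?B) g)" .
  define M where "M = filter_mset (\<lambda>p. \<not> T p) N"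
  have size: "t = size (filter_mset T N) + size M"
    unfolding M_def N(1)[symmetric] by (induction N) auto
  have M: "\<forall>(x, y)\<in>#M. x \<in> ?C \<and> y \<in> ?C \<and> {x, y} \<in> E"
  proof safe
    fix x y assume "(x, y) \<in># M"
    then have xy: "{x, y} \<in> E" "x \<notin> ?B" "y \<notin> ?B" using N(2) by (auto simp: M_def T_def)
    \<comment> \<open>An end outside \<open>U\<close> would put the other end into
      \<open>?B\<close>.\<close>
    then have "x \<in> U" "y \<in> U" by (auto simp: nbhd_def insert_commute)
    with xy show "x \<in> ?C" "y \<in> ?C" "{x, y} \<in> E" by (auto simp: core_def Compl_eq_Diff_UNIV)
  qed
  have "?d M \<subseteq># ?d N"
    unfolding M_def by (intro subset_mset.add_mono image_mset_subseteq_mono multiset_filter_subset)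
  then have "?d M \<subseteq># g" using N(3) by (rule subset_mset.order_trans)
  then have "filter_mset (\<lambda>v. v \<in> ?C) (?d M) \<subseteq># filter_mset (\<lambda>v. v \<in> ?C) g"
    by (rule multiset_filter_mono)
  moreover have "filter_mset (\<lambda>v. v \<in> ?C) (?d M) = ?d M"
    by (subst filter_mset_eq_conv) (use M in auto)
  moreover have "\<forall>(x, y)\<in>#M. {x, y} \<in> induced_edges E ?C" using M by (auto simp: induced_edges_def)
  ultimately have "has_edges (induced_edges E ?C) (size M) (filter_mset (\<lambda>v. v \<in> ?C) g)"
    unfolding has_edges_def edge_sum_def by metis
  then show ?thesis using T size by (elim has_edges_mono) auto
qed

text \<open>Each vertex of \<open>g\<close> is matched with a neighbour in \<open>Z\<close>; one
  full copy of \<open>Z\<close> per vertex makes any choice of neighbour available.\<close>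

lemma edges_into_nbhd:
  assumes "finite Z" "set_mset g \<subseteq> nbhd E Z"
  shows "has_edges E (size g) (g + repeat_mset (size g) (mset_set Z))"
  using assms(2)
proof (induction g)
  case (add u g)
  then obtain z where z: "z \<in> Z" "{u, z} \<in> E" by (auto simp: nbhd_def insert_commute)
  have "{#z#} \<subseteq># mset_set Z" using z(1) assms(1) by simp
  then have "g + repeat_mset (size g) (mset_set Z) + {#u, z#}
      \<subseteq># add_mset u g + repeat_mset (size (add_mset u g)) (mset_set Z)"
    by simp
  moreover have "has_edges E (Suc (size g)) (g + repeat_mset (size g) (mset_set Z) + {#u, z#})"
    using add z(2) unfolding has_edges_Suc by auto
  ultimately show ?case by (auto elim: has_edges_mono)
qed (simp add: has_edges_0)

lemma edges_replicate:
  "{x, y} \<in> E \<Longrightarrow> has_edges E n (replicate_mset n x + replicate_mset n y)"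
proof (induction n)
  case (Suc n)
  then have "has_edges E (Suc n) (replicate_mset n x + replicate_mset n y + {#x, y#})"
    unfolding has_edges_Suc by blast
  then show ?case by (simp add: add_mset_commute)
qed (simp add: has_edges_0)

text \<open>Multipliers outside \<open>U\<close> are free, so the \<open>m\<close> occurrences of
  neighbourhood vertices in \<open>h\<close> can all be matched there. The core then holds fewer
  than \<open>t - m\<close> edges, but \<open>t - m\<close> once any core vertex is added, which
  \<open>no_bipartite_part\<close> forbids on a bipartite component.\<close>

lemma colon_witness_necessary:
  fixes E :: "'v::finite set set"
  assumes G: "simple_graph UNIV E" and w: "colon_witness E t U h"
  shows "independent_set E (- U)"
    "K \<in> components_graph (core UNIV E U) (induced_edges E (core UNIV E U)) \<Longrightarrow>
      has_odd_cycle (induced_edges E K)"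
proof -
  let ?B = "nbhd E (- U)" and ?C = "core UNIV E U"
  let ?F = "induced_edges E ?C"
  show ind: "independent_set E (- U)"
    unfolding independent_set_def
  proof (intro ballI notI)
    fix u v assume uv: "u \<in> - U" "v \<in> - U" "{u, v} \<in> E"
    \<comment> \<open>Enough copies of an edge outside \<open>U\<close> would push \<open>h\<close>
      into the power without touching \<open>U\<close>.\<close>
    let ?c = "replicate_mset t u + replicate_mset t v"
    have "has_edges E t (?c + h)" using edges_replicate[OF uv(3)] by (rule has_edges_mono) auto
    then have "set_mset ?c \<inter> U \<noteq> {}" using w unfolding colon_witness_def by blast
    then show False using uv by (auto split: if_splits)
  qed
  have BC: "?B \<inter> ?C = {}" by (auto simp: core_def Compl_eq_Diff_UNIV)
  define m where "m = size (filter_mset (\<lambda>v. v \<in> ?B) h)"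
  have 1: "j + m < t" if j: "has_edges ?F j h" for j
  proof (rule ccontr)
    assume "\<not> j + m < t"
    let ?B' = "filter_mset (\<lambda>v. v \<in> ?B) h" and ?C' = "filter_mset (\<lambda>v. v \<in> ?C) h"
    \<comment> \<open>A multiplier outside \<open>U\<close> with enough copies to match all
      \<open>m\<close> occurrences.\<close>
    let ?Z = "repeat_mset m (mset_set (- U))"
    have "has_edges E j ?C'"
    proof -
      obtain b where b: "edge_sum ?F j b" "b \<subseteq># h" using j unfolding has_edges_def by blast
      have "set_mset b \<subseteq> ?C" using b(1) by (fastforce simp: edge_sum_def induced_edges_def)
      then have "filter_mset (\<lambda>v. v \<in> ?C) b = b" by (subst filter_mset_eq_conv) auto
      then have "b \<subseteq># ?C'" using multiset_filter_mono[OF b(2)] by metis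
      then show ?thesis unfolding has_edges_def
        using edge_sum_mono[OF b(1), of E] by (auto simp: induced_edges_def)
    qed
    moreover have "has_edges E m (?B' + ?Z)"
      using edges_into_nbhd[of "- U" ?B' E] by (auto simp: m_def)
    ultimately have "has_edges E (j + m) (?C' + (?B' + ?Z))" by (rule has_edges_add)
    moreover have "?C' + (?B' + ?Z) \<subseteq># ?Z + h"
      using BC by (intro mset_subset_eqI) auto
    ultimately have "has_edges E t (?Z + h)"
      using \<open>\<not> j + m < t\<close> by (auto elim: has_edges_mono)
    then have "set_mset ?Z \<inter> U \<noteq> {}" using w unfolding colon_witness_def by blast
    moreover have "set_mset ?Z \<subseteq> set_mset (mset_set (- U))"
      by (rule subsetI) (metis count_repeat_mset mult_0_right count_eq_zero_iff)
    ultimately show False by auto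
  qed
  have mt: "m < t" using 1[OF has_edges_0] by simp
  have 2: "has_edges ?F (t - m) (add_mset v h)" if v: "v \<in> ?C" for v
  proof -
    have "v \<in> U" "v \<notin> ?B" using v BC by (auto simp: core_def)
    then have "has_edges E t ({#v#} + h)"
      using w[unfolded colon_witness_def, rule_format, of "{#v#}"] by simp
    from edges_outside_nbhd[OF ind this] \<open>v \<notin> ?B\<close>
    have "has_edges ?F (t - m) (filter_mset (\<lambda>v. v \<in> ?C) (add_mset v h))" by (simp add: m_def)
    then show ?thesis by (rule has_edges_mono[OF _ order_refl multiset_filter_subset order_refl])
  qed
  have F: "simple_graph ?C ?F" using induced_simple_graph[OF G] by simp
  show "has_odd_cycle (induced_edges E K)" if K: "K \<in> components_graph ?C ?F"
  proof (rule ccontr)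
    note props = component_props[OF F K]
    have eq: "induced_edges ?F K = induced_edges E K"
      using props(1) by (auto simp: induced_edges_def)
    assume "\<not> has_odd_cycle (induced_edges E K)"
    then have "bipartite_graph K (induced_edges ?F K)"
      using bipartite_if_no_odd_cycle[OF props(4,5)] eq by simp
    then obtain A B where AB: "A \<union> B = K" "A \<inter> B = {}"
      "\<forall>e\<in>induced_edges ?F K. \<exists>a\<in>A. \<exists>b\<in>B. e = {a, b}" by (auto simp: bipartite_graph_def)
    obtain v where v: "v \<in> K" using props(2) by blast
    have tm: "Suc (t - m - 1) = t - m" using mt by simp
    show False
    proof (rule no_bipartite_part[OF _ AB(1,2) v])
      show "\<exists>a\<in>A. \<exists>b\<in>B. e = {a, b}" if "e \<in> ?F" "e \<inter> K \<noteq> {}" for e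
        using AB(3) props(3)[OF that] that(1) by (auto simp: induced_edges_def)
      show "\<not> has_edges ?F (Suc (t - m - 1)) h" unfolding tm using 1[of "t - m"] mt by auto
      show "has_edges ?F (Suc (t - m - 1)) (add_mset v h)" if "v \<in> K" for v
        unfolding tm using 2[of v] that props(1) by blast
    qed
  qed
qed

text \<open>Copies of one neighbourhood vertex \<open>b\<close>, matched with plentiful copies of
  \<open>- U\<close>, supply the edges missing from \<open>t\<close>. A new vertex in
  \<open>U\<close> adds the decisive edge, in the core or towards \<open>- U\<close>, whereas
  vertices outside \<open>U\<close> change nothing.\<close>

lemma colon_witness_sufficient:
  fixes E :: "'v::finite set set"
  assumes ind: "independent_set E (- U)" and b: "b \<in> nbhd E (- U)" and t: "Suc r \<le> t"
    and a: "set_mset a \<subseteq> core UNIV E U"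
      "has_edges (induced_edges E (core UNIV E U)) r a"
      "\<And>v. v \<in> core UNIV E U \<Longrightarrow> has_edges (induced_edges E (core UNIV E U)) (Suc r) (add_mset v a)"
      "\<not> has_edges (induced_edges E (core UNIV E U)) (Suc r) a"
  shows "\<exists>h. colon_witness E t U h"
proof -
  let ?B = "nbhd E (- U)" and ?C = "core UNIV E U"
  let ?F = "induced_edges E ?C"
  let ?Z = "\<lambda>n. repeat_mset n (mset_set (- U))"
  let ?n = "t - Suc r"
  \<comment> \<open>The \<open>?n\<close> copies of \<open>b\<close> leave exactly
    \<open>Suc r\<close> edges to the core, one more than \<open>a\<close> holds; \<open>t\<close>
    copies of the complement suffice for up to \<open>t\<close> edges into it.\<close>
  let ?h = "a + replicate_mset ?n b + ?Z t"
  have BU: "?B \<subseteq> U" using ind by (auto simp: nbhd_def independent_set_def)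
  have BC: "?B \<inter> ?C = {}" and CU: "?C \<subseteq> U" by (auto simp: core_def Compl_eq_Diff_UNIV)
  have FE: "?F \<subseteq> E" by (auto simp: induced_edges_def)
  have Z: "\<exists>W. ?Z t = ?Z m + W" if "m \<le> t" for m
    using that by (intro exI[of _ "?Z (t - m)"] multiset_eqI) (simp flip: distrib_right)
  have bs: "has_edges E (size g) (g + ?Z (size g))" if "set_mset g \<subseteq> ?B" for g
    using edges_into_nbhd[OF _ that] by simp
  have "has_edges E t (c + ?h)" if u: "u \<in># c" "u \<in> U" for c u
  proof -
    obtain d where d: "c = add_mset u d" using u(1) by (metis mset_add)
    show ?thesis
    proof (cases "u \<in> ?C")
      case True
      have "has_edges E (Suc r) (add_mset u a)" using has_edges_mono[OF a(3)[OF True] _ _ FE] by simp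
      moreover have "has_edges E ?n (replicate_mset ?n b + ?Z ?n)"
        using bs[of "replicate_mset ?n b"] b by (auto split: if_splits)
      ultimately have "has_edges E (Suc r + ?n) (add_mset u a + (replicate_mset ?n b + ?Z ?n))"
        by (rule has_edges_add)
      moreover obtain W where "?Z t = ?Z ?n + W" using Z[of ?n] by auto
      then have "c + ?h = (add_mset u a + (replicate_mset ?n b + ?Z ?n)) + (d + W)" by (simp add: d)
      then have "add_mset u a + (replicate_mset ?n b + ?Z ?n) \<subseteq># c + ?h"
        by (metis mset_subset_eq_add_left)
      ultimately show ?thesis using t by (auto elim: has_edges_mono)
    next
      case False
      then have uB: "u \<in> ?B" using u(2) by (auto simp: core_def Compl_eq_Diff_UNIV)
      have "has_edges E r a" using has_edges_mono[OF a(2) _ _ FE] by simp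
      \<comment> \<open>Here \<open>u\<close> itself is matched with the complement, replacing the
        missing core edge.\<close>
      moreover have "has_edges E (Suc ?n) (add_mset u (replicate_mset ?n b) + ?Z (Suc ?n))"
        using bs[of "add_mset u (replicate_mset ?n b)"] b uB by (auto split: if_splits)
      ultimately have "has_edges E (r + Suc ?n) (a + (add_mset u (replicate_mset ?n b) + ?Z (Suc ?n)))"
        by (rule has_edges_add)
      moreover have "Suc ?n \<le> t" using t by linarith
      then obtain W where "?Z t = ?Z (Suc ?n) + W" using Z by blast
      then have "c + ?h = (a + (add_mset u (replicate_mset ?n b) + ?Z (Suc ?n))) + (d + W)" by (simp add: d)
      then have "a + (add_mset u (replicate_mset ?n b) + ?Z (Suc ?n)) \<subseteq># c + ?h"
        by (metis mset_subset_eq_add_left)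
      ultimately show ?thesis using t by (auto elim: has_edges_mono)
    qed
  qed
  moreover have False if h: "has_edges E t (c + ?h)" and c: "set_mset c \<inter> U = {}" for c
  proof -
    \<comment> \<open>\<open>c\<close> avoids \<open>U\<close>, so it alters neither the
      neighbourhood part nor the core part of \<open>?h\<close>.\<close>
    have B: "filter_mset (\<lambda>v. v \<in> ?B) (c + ?h) = replicate_mset ?n b"
    proof (rule multiset_eqI)
      fix v
      have "v \<in> ?B \<Longrightarrow> v \<notin># c \<and> v \<notin># a \<and> v \<in> U" using c a(1) BC BU by blast
      then show "count (filter_mset (\<lambda>v. v \<in> ?B) (c + ?h)) v = count (replicate_mset ?n b) v"
        using b by (auto simp: count_eq_zero_iff)
    qed
    have C: "filter_mset (\<lambda>v. v \<in> ?C) (c + ?h) = a"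
    proof (rule multiset_eqI)
      fix v
      have "v \<in> ?C \<Longrightarrow> v \<notin># c \<and> v \<noteq> b \<and> v \<in> U" "v \<notin> ?C \<Longrightarrow> v \<notin># a" using c a(1) BC CU b by blast+
      then show "count (filter_mset (\<lambda>v. v \<in> ?C) (c + ?h)) v = count a v"
        by (auto simp: count_eq_zero_iff)
    qed
    have "t - ?n = Suc r" using t by simp
    then show False using edges_outside_nbhd[OF ind h] a(4) unfolding B C by simp
  qed
  ultimately have "colon_witness E t U ?h"
    unfolding colon_witness_def by blast
  then show ?thesis by blast
qed

text \<open>Pad \<open>a\<close> with \<open>t - Suc r\<close> copies of one edge: the size
  \<open>2 * t - 1\<close> is one too small for \<open>t\<close> edges, while any added vertex makes
  them fit.\<close>

lemma colon_witness_UNIV: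
  assumes a: "size a = 2 * r + 1" "\<And>v. has_edges E (Suc r) (add_mset v a)"
    and e: "{x, y} \<in> E" and t: "Suc r \<le> t"
  shows "\<exists>h. colon_witness E t UNIV h"
proof -
  let ?n = "t - Suc r"
  let ?e = "replicate_mset ?n x + replicate_mset ?n y"
  have "\<not> has_edges E t (a + ?e)"
  proof
    assume "has_edges E t (a + ?e)"
    then obtain b where b: "edge_sum E t b" "b \<subseteq># a + ?e" unfolding has_edges_def by blast
    then have "2 * t \<le> size (a + ?e)" using edge_sum_size[OF b(1)] size_mset_mono[OF b(2)] by simp
    then show False using t a(1) by simp
  qed
  moreover have "has_edges E t (c + (a + ?e))" if c: "c \<noteq> {#}" for c
  proof -
    obtain v d where d: "c = add_mset v d" using c by (metis multi_nonempty_split)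
    have "has_edges E (Suc r + ?n) (add_mset v a + ?e)"
      by (rule has_edges_add[OF a(2) edges_replicate[OF e]])
    then show ?thesis by (rule has_edges_mono) (use t in \<open>auto simp: d\<close>)
  qed
  ultimately have "has_edges E t (c + (a + ?e)) \<longleftrightarrow> set_mset c \<inter> UNIV \<noteq> {}" for c
    by (cases "c = {#}") simp_all
  then have "colon_witness E t UNIV (a + ?e)" unfolding colon_witness_def by blast
  then show ?thesis by blast
qed

section \<open>The bounds for \<open>dstab\<close> and \<open>astab\<close>\<close>

theorem theorem4p12:
  fixes E :: "'v::finite set set"
  assumes "simple_graph UNIV E"
    and "connected_graph UNIV E"
    and "\<not> bipartite_graph UNIV E"
  shows "ereal_of_enat (dstab (edge_ideal E :: ('v, 'k::field) mpoly set))
           \<le> ereal ((real (card E) + real (num_bridges UNIV E) - 1) / 2 + 1)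
       \<and> ereal_of_enat (astab (edge_ideal E :: ('v, 'k) mpoly set))
           \<le> ereal (Max {(real (card (induced_edges E (core UNIV E U)))
                 + real (num_bridges (core UNIV E U) (induced_edges E (core UNIV E U))) - 1) / 2 + 1
               | U. admissible UNIV E U})"
proof -
  let ?C = "core UNIV E"
  let ?F = "\<lambda>U. induced_edges E (?C U)"
  let ?b = "\<lambda>U. (real (card (?F U)) + real (num_bridges (?C U) (?F U)) - 1) / 2 + 1"
  let ?I = "edge_ideal E :: ('v, 'k) mpoly set"
  \<comment> \<open>For \<open>U = UNIV\<close> the core is the whole graph, so the first bound is
    one of the terms of the maximum.\<close>
  have C_UNIV: "?C UNIV = UNIV" "?F UNIV = E" by (auto simp: core_def nbhd_def induced_edges_def)
  have odd: "has_odd_cycle E" using bipartite_if_no_odd_cycle[OF assms(1,2)] assms(3) by blast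
  have comp: "components_graph UNIV E = {UNIV}" by (rule components_connected_graph[OF assms(2)])
  obtain a0 r0 where a0: "\<And>v. has_edges E (Suc r0) (add_mset v a0)"
    "2 * r0 + 1 \<le> card E + num_bridges UNIV E" "size a0 = 2 * r0 + 1"
    using components_witness[OF assms(1)] comp odd assms(2) C_UNIV by auto
  obtain a' where "critical E UNIV a'" using critical_exists[OF assms(1,2) odd] by blast
  then have nbr: "\<exists>w. {v, w} \<in> E" for v by (auto simp: critical_def)
  then obtain x y where xy: "{x, y} \<in> E" by blast
  have top: "\<exists>h. colon_witness E t UNIV h" if "Suc r0 \<le> t" for t
    by (rule colon_witness_UNIV[OF a0(3,1) xy that])
  obtain h0 where "colon_witness E (Suc r0) UNIV h0" using top by blast
  from Ass_powI[OF _ this, where 'k = 'k] have "max_ideal \<in> Ass_pow ?I (Suc r0)"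
    using primeideal_max_ideal unfolding max_ideal_eq by blast
  then have "dstab ?I \<le> enat (Suc r0)"
    unfolding dstab_def by (intro Inf_lower) auto
  then have "ereal_of_enat (dstab ?I) \<le> ereal_of_enat (enat (Suc r0))"
    by (simp only: ereal_of_enat_le_iff)
  also have "\<dots> \<le> ereal ((real (card E) + real (num_bridges UNIV E) - 1) / 2 + 1)"
    using a0(2) by simp
  finally have dstab: "ereal_of_enat (dstab ?I) \<le> ereal ((real (card E) + real (num_bridges UNIV E) - 1) / 2 + 1)" .
  \<comment> \<open>\<open>astab\<close> needs a natural number, so the maximum is rounded down; an
    integer \<open>Suc r\<close> below the maximum stays below \<open>k\<close>.\<close>
  define k where "k = nat \<lfloor>Max {?b U | U. admissible UNIV E U}\<rfloor>"
  have bound: "Suc r \<le> k \<and> real k \<le> Max {?b U | U. admissible UNIV E U}"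
    if "admissible UNIV E U" "2 * r + 1 \<le> card (?F U) + num_bridges (?C U) (?F U)" for U r
  proof -
    have "{?b U | U. admissible UNIV E U} = ?b ` {U. admissible UNIV E U}" by auto
    then have "?b U \<le> Max {?b U | U. admissible UNIV E U}"
      using that(1) by (intro Max_ge) auto
    moreover have "real (Suc r) \<le> ?b U" using that(2) by simp
    ultimately have *: "real (Suc r) \<le> Max {?b U | U. admissible UNIV E U}" by linarith
    then show ?thesis unfolding k_def by (auto simp: le_nat_floor of_nat_floor)
  qed
  have "admissible UNIV E UNIV"
    using odd comp C_UNIV by (simp add: admissible_def independent_set_def nbhd_def induced_edges_def)
  then have k: "Suc r0 \<le> k" "real k \<le> Max {?b U | U. admissible UNIV E U}"
    using bound[of UNIV r0] a0(2) C_UNIV by auto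
  \<comment> \<open>A set \<open>U\<close> with a witness for some exponent has one for every
    exponent from \<open>k\<close> on; only the monomial changes.\<close>
  have exchange: "\<exists>h. colon_witness E t' U h" if w: "colon_witness E t U h" and t': "k \<le> t'" for t t' U h
  proof (cases "nbhd E (- U) = {}")
    case True
    \<comment> \<open>No vertex is isolated, so a vertex outside \<open>U\<close> would have a
      neighbour.\<close>
    have "v \<in> U" for v using True nbr[of v] by (auto simp: nbhd_def)
    then have "U = UNIV" by blast
    then show ?thesis using top k(1) t' by simp
  next
    case False
    then obtain b where b: "b \<in> nbhd E (- U)" by blast
    note nec = colon_witness_necessary[OF assms(1) w]
    show ?thesis
    proof (cases "?C U = {}")
      case True
      \<comment> \<open>An empty core means \<open>U = nbhd E (- U)\<close>, which the maximum
        excludes; the empty multiset with \<open>r = 0\<close> serves as core part.\<close>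
      have "\<not> has_edges (?F U) (Suc 0) {#}" by (auto simp: has_edges_Suc)
      with True show ?thesis
        using k(1) t' by (intro colon_witness_sufficient[OF nec(1) b, of 0 _ "{#}"]) (auto simp: has_edges_0)
    next
      case C: False
      have adm: "admissible UNIV E U"
        using nec C by (auto simp: admissible_def core_def Compl_eq_Diff_UNIV)
      have F: "simple_graph (?C U) (?F U)" using induced_simple_graph[OF assms(1)] by simp
      have "induced_edges (?F U) K = induced_edges E K"
        if "K \<in> components_graph (?C U) (?F U)" for K
        using component_props(1)[OF F that] by (auto simp: induced_edges_def)
      then have "has_odd_cycle (induced_edges (?F U) K)"
        if "K \<in> components_graph (?C U) (?F U)" for K
        using nec(2) that by simp
      from components_witness[OF F C this] obtain a r where a: "set_mset a \<subseteq> ?C U"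
        "has_edges (?F U) r a" "\<And>v. v \<in> ?C U \<Longrightarrow> has_edges (?F U) (Suc r) (add_mset v a)"
        "\<not> has_edges (?F U) (Suc r) a" "2 * r + 1 \<le> card (?F U) + num_bridges (?C U) (?F U)"
        by blast
      have "Suc r \<le> t'" using bound[OF adm a(5)] t' by simp
      from colon_witness_sufficient[OF nec(1) b this a(1-4)] show ?thesis .
    qed
  qed
  \<comment> \<open>As \<open>s\<close> is arbitrary, two exponents from \<open>k\<close> on can be
    used in both orders, which gives equality.\<close>
  have "Ass_pow ?I s \<subseteq> Ass_pow ?I t" if "k \<le> t" for s t
  proof
    fix P assume P: "P \<in> Ass_pow ?I s"
    from Ass_powD(2)[OF this] obtain U h where U: "P = monomial_ideal (meets U)" "colon_witness E s U h"
      by blast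
    obtain h' where "colon_witness E t U h'" using exchange[OF U(2) \<open>k \<le> t\<close>] by blast
    then show "P \<in> Ass_pow ?I t" using Ass_powI Ass_powD(1)[OF P] U(1) by blast
  qed
  then have "Ass_pow ?I k = Ass_pow ?I (k + i)" for i by (meson le_add1 order_refl subset_antisym)
  then have "astab ?I \<le> enat k"
    using k(1) unfolding astab_def by (intro Inf_lower) auto
  then have "ereal_of_enat (astab ?I) \<le> ereal_of_enat (enat k)"
    by (simp only: ereal_of_enat_le_iff)
  also have "\<dots> \<le> ereal (Max {?b U | U. admissible UNIV E U})" using k(2) by simp
  finally show ?thesis using dstab by blast
qed

end
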